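(* Let $m,d_1,d_2\in\mathbb{N}$ be positive integers, and let $A_l\in\mathbb{C}^{d_1\times d_1}$ and $B_l\in\mathbb{C}^{d_2\times d_2}$ for $l\in\{1,\ldots,m\}$ be arbitrary matrices. Then $$\sigma\Big(\sum_{l=1}^m A_l\otimes B_l\Big)\ \prec_w\ \sum_{l=1}^m\sigma(A_l)\otimes\sigma(B_l).$$ If, moreover, all the matrices $A_l$ and $B_l$ are positive semidefinite, then singular values become eigenvalues and weak majorization becomes majorization, i.e. $$\lambda\Big(\sum_{l=1}^m A_l\otimes B_l\Big)\ \prec\ \sum_{l=1}^m\lambda(A_l)\otimes\lambda(B_l).$$
   Context: For $A\in\mathbb{C}^{d\times d}$, $\sigma(A)=(\sigma_1(A),\ldots,\sigma_d(A))\in\mathbb{R}^d$ denotes the vector of singular values (with multiplicity) in nonincreasing order $\sigma_1(A)\geq\cdots\geq\sigma_d(A)$; if $A$ is Hermitian, $\lambda(A)=(\lambda_1(A),\ldots,\lambda_d(A))\in\mathbb{R}^d$ denotes the vector of eigenvalues (with multiplicity) in nonincreasing order. For matrices, $\otimes$ is the Kronecker (tensor) product; for vectors $x\in\mathbb{R}^{d_1}$, $y\in\mathbb{R}^{d_2}$, $x\otimes y\in\mathbb{R}^{d_1d_2}$ is the vector with entries $x_iy_j$ indexed by pairs $(i,j)$, and sums of such vectors are taken entrywise at the same index $(i,j)$. For $x,y\in\mathbb{R}^d$, weak majorization $x\prec_w y$ means $\sum_{i=1}^k x_i^\downarrow\leq\sum_{i=1}^k y_i^\downarrow$ for all $k\in\{1,\ldots,d\}$,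 where $x^\downarrow$ is the rearrangement of the entries of $x$ in nonincreasing order; majorization $x\prec y$ means that in addition equality holds for $k=d$. *)

theory Defs
  imports
    "Jordan_Normal_Form.Schur_Decomposition"
    "HOL-Computational_Algebra.Fundamental_Theorem_Algebra"
    "HOL-Library.Multiset"
begin

text \<open>Matrices and vectors are those of \<open>Jordan_Normal_Form\<close>, whose indices start at \<open>0\<close>; the
  conjugate transpose is \<^const>\<open>mat_adjoint\<close>.\<close>

section \<open>Tensor products and sums\<close>

text \<open>The pair \<open>(i, j)\<close> with \<open>i < d\<^sub>1\<close> and \<open>j < d\<^sub>2\<close> is encoded as the index \<open>i * d\<^sub>2 + j\<close>.\<close>

definition tensor_vec :: "'a :: times vec \<Rightarrow> 'a vec \<Rightarrow> 'a vec" where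
  "tensor_vec x y = vec (dim_vec x * dim_vec y)
     (\<lambda>p. x $ (p div dim_vec y) * y $ (p mod dim_vec y))"

definition tensor_mat :: "'a :: times mat \<Rightarrow> 'a mat \<Rightarrow> 'a mat" where
  "tensor_mat A B = mat (dim_row A * dim_row B) (dim_col A * dim_col B)
     (\<lambda>(p, q). A $$ (p div dim_row B, q div dim_col B) * B $$ (p mod dim_row B, q mod dim_col B))"

text \<open>The analogue of \<^const>\<open>finsum_vec\<close>.\<close>

definition finsum_mat ::
  "'a :: monoid_add itself \<Rightarrow> nat \<Rightarrow> nat \<Rightarrow> ('c \<Rightarrow> 'a mat) \<Rightarrow> 'c set \<Rightarrow> 'a mat" where
  "finsum_mat ty nr nc = finprod (monoid_mat ty nr nc)"

lemma tensor_vec_carrier [simp, intro]: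
  "x \<in> carrier_vec d1 \<Longrightarrow> y \<in> carrier_vec d2 \<Longrightarrow> tensor_vec x y \<in> carrier_vec (d1 * d2)"
  by (auto simp: tensor_vec_def)

lemma tensor_mat_carrier [simp, intro]:
  "A \<in> carrier_mat r1 c1 \<Longrightarrow> B \<in> carrier_mat r2 c2 \<Longrightarrow>
   tensor_mat A B \<in> carrier_mat (r1 * r2) (c1 * c2)"
  by (auto simp: tensor_mat_def)

lemma pair_index_less:
  fixes i j d1 d2 :: nat
  assumes "i < d1" "j < d2"
  shows "i * d2 + j < d1 * d2"
proof -
  have "i * d2 + j < Suc i * d2" using assms by simp
  also have "\<dots> \<le> d1 * d2" using assms by (intro mult_le_mono1) simp
  finally show ?thesis .
qed

lemma index_tensor_vec:
  assumes "i < dim_vec x" "j < dim_vec y"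
  shows "tensor_vec x y $ (i * dim_vec y + j) = x $ i * y $ j"
  using assms pair_index_less[OF assms] by (simp add: tensor_vec_def)

lemma index_tensor_mat:
  assumes "i < dim_row A" "j < dim_row B" "k < dim_col A" "l < dim_col B"
  shows "tensor_mat A B $$ (i * dim_row B + j, k * dim_col B + l) = A $$ (i, k) * B $$ (j, l)"
  using assms pair_index_less[OF assms(1,2)] pair_index_less[OF assms(3,4)]
  by (simp add: tensor_mat_def)

lemma finsum_mat_carrier:
  fixes f :: "'c \<Rightarrow> 'a :: comm_monoid_add mat"
  assumes "f \<in> F \<rightarrow> carrier_mat nr nc"
  shows "finsum_mat TYPE('a) nr nc f F \<in> carrier_mat nr nc"
  using comm_monoid.finprod_closed[OF comm_monoid_mat[where nr = nr and nc = nc], of f F] assms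
  by (simp add: finsum_mat_def monoid_mat_def)

lemma index_finsum_mat:
  fixes f :: "'c \<Rightarrow> 'a :: comm_monoid_add mat"
  assumes "finite F" "i < nr" "j < nc" "f \<in> F \<rightarrow> carrier_mat nr nc"
  shows "finsum_mat TYPE('a) nr nc f F $$ (i, j) = (\<Sum>k\<in>F. f k $$ (i, j))"
  using assms(1,4)
proof (induction F rule: finite_induct)
  case empty
  then show ?case
    using assms comm_monoid.finprod_empty[OF comm_monoid_mat[where nr = nr and nc = nc], of f]
    by (simp add: finsum_mat_def monoid_mat_def)
next
  case (insert a F)
  have "finsum_mat TYPE('a) nr nc f (insert a F) = f a + finsum_mat TYPE('a) nr nc f F"
    using insert comm_monoid.finprod_insert[OF comm_monoid_mat[where nr = nr and nc = nc], of F a f]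
    by (auto simp: finsum_mat_def monoid_mat_def)
  moreover have "finsum_mat TYPE('a) nr nc f F \<in> carrier_mat nr nc"
    using insert by (intro finsum_mat_carrier) auto
  ultimately show ?case using insert assms by auto
qed

section \<open>Spectral vectors\<close>

definition hermitian_mat :: "complex mat \<Rightarrow> bool" where
  "hermitian_mat A \<longleftrightarrow> square_mat A \<and> mat_adjoint A = A"

definition psd_mat :: "complex mat \<Rightarrow> bool" where
  "psd_mat A \<longleftrightarrow>
     hermitian_mat A \<and> (\<forall>v\<in>carrier_vec (dim_row A). 0 \<le> Re ((A *\<^sub>v v) \<bullet>c v))"

text \<open>Intended for Hermitian matrices only: their eigenvalues are real (see
  \<open>hermitian_eigenvalue_real\<close> below), so that \<^const>\<open>Re\<close> is just the coercion to the reals.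
  The multiplicity is that of the root of the characteristic polynomial.\<close>

definition eigenvalue_vec :: "complex mat \<Rightarrow> real vec" where
  "eigenvalue_vec A =
     vec_of_list (rev (sorted_list_of_multiset (image_mset Re (proots (char_poly A)))))"

text \<open>Taking square roots preserves the nonincreasing order.\<close>

definition singular_value_vec :: "complex mat \<Rightarrow> real vec" where
  "singular_value_vec A = map_vec sqrt (eigenvalue_vec (mat_adjoint A * A))"

lemma mat_adjoint_dims [simp]:
  "dim_row (mat_adjoint A) = dim_col A" "dim_col (mat_adjoint A) = dim_row A"
  by (simp_all add: mat_adjoint_def)

lemma index_mat_adjoint:
  "i < dim_col A \<Longrightarrow> j < dim_row A \<Longrightarrow> mat_adjoint A $$ (i, j) = conjugate (A $$ (j, i))"
  by (simp add: mat_adjoint_def mat_of_rows_index)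

lemma eigenvalue_vec_carrier [simp, intro]:
  assumes "A \<in> carrier_mat d d"
  shows "eigenvalue_vec A \<in> carrier_vec d"
proof -
  have "length (sorted_list_of_multiset M) = size M" for M :: "real multiset"
    unfolding size_mset[symmetric] mset_sorted_list_of_multiset ..
  then have "dim_vec (eigenvalue_vec A) = degree (char_poly A)"
    by (simp add: eigenvalue_vec_def size_proots_complex)
  also have "\<dots> = d" using degree_monic_char_poly[OF assms] by blast
  finally show ?thesis by (rule carrier_vecI)
qed

lemma singular_value_vec_carrier [simp, intro]:
  assumes "A \<in> carrier_mat d d"
  shows "singular_value_vec A \<in> carrier_vec d"
proof -
  have "mat_adjoint A * A \<in> carrier_mat d d"
    using assms by (intro mult_carrier_mat[of _ d d] carrier_matI) auto
  then have "eigenvalue_vec (mat_adjoint A * A) \<in> carrier_vec d"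
    by (rule eigenvalue_vec_carrier)
  then show ?thesis unfolding singular_value_vec_def map_carrier_vec .
qed

lemma hermitian_eigenvalue_real:
  assumes "hermitian_mat A" "e \<in># proots (char_poly A)"
  shows "e \<in> \<real>"
proof -
  define n where "n = dim_row A"
  have A: "A \<in> carrier_mat n n" and adj: "mat_adjoint A = A"
    using assms(1) by (auto simp: hermitian_mat_def n_def)
  have "char_poly A \<noteq> 0" using degree_monic_char_poly[OF A] by auto
  then have "eigenvalue A e"
    using assms(2) eigenvalue_root_char_poly[OF A] by simp
  then obtain v where v: "v \<in> carrier_vec n" "v \<noteq> 0\<^sub>v n" "A *\<^sub>v v = e \<cdot>\<^sub>v v"
    using A unfolding eigenvalue_def eigenvector_def by auto
  have cA: "cnj (A $$ (i, j)) = A $$ (j, i)" if "i < n" "j < n" for i j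
    using index_mat_adjoint[of j A i] that A adj by auto
  have "(A *\<^sub>v v) \<bullet>c v = (\<Sum>i<n. \<Sum>j<n. A $$ (i, j) * v $ j * cnj (v $ i))"
    using A v(1) by (simp add: scalar_prod_def lessThan_atLeast0 sum_distrib_right)
  also have "\<dots> = (\<Sum>j<n. \<Sum>i<n. A $$ (i, j) * v $ j * cnj (v $ i))"
    by (rule sum.swap)
  also have "\<dots> = (\<Sum>j<n. \<Sum>i<n. cnj (A $$ (j, i) * v $ i * cnj (v $ j)))"
    by (intro sum.cong refl) (simp add: cA mult_ac)
  also have "\<dots> = cnj ((A *\<^sub>v v) \<bullet>c v)"
    using A v(1) by (simp add: scalar_prod_def lessThan_atLeast0 sum_distrib_right)
  finally have "e * (v \<bullet>c v) = cnj (e * (v \<bullet>c v))"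
    using v by simp
  moreover have "cnj (v \<bullet>c v) = v \<bullet>c v"
    by (simp add: scalar_prod_def mult.commute)
  moreover have "v \<bullet>c v \<noteq> 0"
    using v conjugate_square_eq_0_vec[OF v(1)] by simp
  ultimately have "e = cnj e" by simp
  then show ?thesis by (simp add: Reals_cnj_iff)
qed

section \<open>Majorization\<close>

definition decreasing_rearrangement :: "real vec \<Rightarrow> real vec" where
  "decreasing_rearrangement x = vec_of_list (rev (sort (list_of_vec x)))"

definition weakly_majorized_by :: "real vec \<Rightarrow> real vec \<Rightarrow> bool" where
  "weakly_majorized_by x y \<longleftrightarrow> dim_vec x = dim_vec y \<and>
     (\<forall>k\<in>{1..dim_vec x}.
        (\<Sum>i<k. decreasing_rearrangement x $ i) \<le> (\<Sum>i<k. decreasing_rearrangement y $ i))"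

definition majorized_by :: "real vec \<Rightarrow> real vec \<Rightarrow> bool" where
  "majorized_by x y \<longleftrightarrow> weakly_majorized_by x y \<and>
     (\<Sum>i<dim_vec x. decreasing_rearrangement x $ i) =
     (\<Sum>i<dim_vec x. decreasing_rearrangement y $ i)"

end

theory Submission
  imports Defs "HOL-Combinatorics.Permutations"
begin

text \<open>By Ky Fan's variational principle, the sum of the \<open>k\<close> largest singular values of
  \<open>\<Sum>\<^sub>l A\<^sub>l \<otimes> B\<^sub>l\<close> is \<open>Re \<Sum>\<^sub>p \<langle>u\<^sub>p, (\<Sum>\<^sub>l A\<^sub>l \<otimes> B\<^sub>l) v\<^sub>p\<rangle>\<close> for suitable singular vectors.
  Inserting singular value decompositions of \<open>A\<^sub>l\<close> and \<open>B\<^sub>l\<close> and using \<open>Re (s t) \<le> (|s|\<^sup>2 + |t|\<^sup>2) / 2\<close>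
  reduces the claim to bounding \<open>\<Sum> \<alpha>\<^sub>i \<beta>\<^sub>j g(i, j)\<close> with
  \<open>g(i, j) = \<Sum>\<^sub>p |\<langle>w\<^sub>p, a\<^sub>i \<otimes> b\<^sub>j\<rangle>|\<^sup>2\<close>, for \<open>w = u\<close> and for \<open>w = v\<close>. The point is that there are weights
  \<open>\<omega>(i, j)\<close> in \<open>[0, 1]\<close> of total at most \<open>k\<close>, depending on \<open>w\<close> only and not on \<open>a\<close>, \<open>b\<close> (hence not on
  \<open>l\<close>), all of whose corner sums over \<open>i < r, j < s\<close> dominate those of \<open>g\<close>: if \<open>\<rho>\<close> is the spectrum
  of the partial trace of \<open>\<Sum>\<^sub>p w\<^sub>p w\<^sub>p\<^sup>*\<close> over the first factor, take \<open>\<omega>\<close> with column sums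
  \<open>\<Sum>\<^bsub>i < r\<^esub> \<omega>(i, j) = min \<rho>\<^sub>j r\<close>. Abel summation in both indices then replaces \<open>g\<close> by \<open>\<omega>\<close>
  for all decreasing \<open>\<alpha>\<close>, \<open>\<beta>\<close> at once, so that the sum over \<open>l\<close> can be taken inside.\<close>

section \<open>Orthonormal families and the spectral theorem\<close>

text \<open>Vectors are plain functions of which only the values below \<open>d\<close> matter, so
  that a family is extended by a function update.\<close>

definition orthonormal :: "nat \<Rightarrow> nat \<Rightarrow> (nat \<Rightarrow> nat \<Rightarrow> complex) \<Rightarrow> bool" where
  "orthonormal d m u \<longleftrightarrow>
     (\<forall>i<m. \<forall>j<m. (\<Sum>x<d. u i x * cnj (u j x)) = (if i = j then 1 else 0))"

lemma orthonormalD: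
  "orthonormal d m u \<Longrightarrow> i < m \<Longrightarrow> j < m \<Longrightarrow>
     (\<Sum>x<d. u i x * cnj (u j x)) = (if i = j then 1 else 0)"
  by (simp add: orthonormal_def)

text \<open>Padding the \<open>m\<close> equations with zero rows gives a square system whose row
  \<open>m\<close> vanishes, hence a singular one.\<close>

lemma exists_nontrivial_solution:
  fixes M :: "nat \<Rightarrow> nat \<Rightarrow> 'a :: field"
  assumes "m < d"
  obtains z where "\<exists>y<d. z y \<noteq> 0" "\<And>i. i < m \<Longrightarrow> (\<Sum>y<d. M i y * z y) = 0"
proof -
  define c where "c i = vec d (\<lambda>y. if i < m then M i y else 0)" for i
  define N where "N = mat\<^sub>r d d (\<lambda>i. if i = m then 0\<^sub>v d else c i)"
  have N: "N \<in> carrier_mat d d" by (simp add: N_def)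
  have "det N = 0"
    unfolding N_def by (rule det_row_0[OF assms]) (auto simp: c_def)
  then obtain v where v: "v \<in> carrier_vec d" "v \<noteq> 0\<^sub>v d" "N *\<^sub>v v = 0\<^sub>v d"
    using det_0_iff_vec_prod_zero_field[OF N] by blast
  show ?thesis
  proof
    show "\<exists>y<d. v $ y \<noteq> 0" using v(1,2) by (metis eq_vecI carrier_vecD index_zero_vec)
    fix i assume "i < m"
    then have i: "i < d" "i \<noteq> m" using assms by auto
    have "(\<Sum>y<d. M i y * v $ y) = row N i \<bullet> v"
      unfolding N_def c_def using i \<open>i < m\<close> v(1)
      by (simp add: scalar_prod_def lessThan_atLeast0)
    also have "\<dots> = (N *\<^sub>v v) $ i" using N i by simp
    finally show "(\<Sum>y<d. M i y * v $ y) = 0" using v(3) i by simp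
  qed
qed

lemma sum_cnj_self: "(\<Sum>x<d. u x * cnj (u x)) = of_real (\<Sum>x<d. (cmod (u x))\<^sup>2)"
  by (simp only: of_real_sum complex_norm_square)

lemma orthonormal_append:
  assumes u: "orthonormal d m u" and z: "\<exists>y<d. z y \<noteq> 0"
    and zu: "\<And>i. i < m \<Longrightarrow> (\<Sum>x<d. z x * cnj (u i x)) = 0"
  obtains c where "orthonormal d (Suc m) (u(m := \<lambda>x. c * z x))"
proof -
  define N where "N = (\<Sum>x<d. (cmod (z x))\<^sup>2)"
  have "N > 0" unfolding N_def using z by (auto intro!: sum_pos2)
  define c where "c = complex_of_real (1 / sqrt N)"
  have "(\<Sum>x<d. c * z x * cnj (c * z x)) = c * cnj c * (\<Sum>x<d. z x * cnj (z x))"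
    by (simp add: sum_distrib_left mult_ac)
  also have "c * cnj c = of_real (1 / N)"
    using \<open>N > 0\<close> by (simp add: c_def flip: of_real_mult)
  finally have cc: "(\<Sum>x<d. c * z x * cnj (c * z x)) = 1"
    using \<open>N > 0\<close> by (simp add: sum_cnj_self flip: N_def)
  have cu: "(\<Sum>x<d. c * z x * cnj (u i x)) = 0" if "i < m" for i
    using zu[OF that] by (simp add: mult.assoc flip: sum_distrib_left)
  have uc: "(\<Sum>x<d. u i x * cnj (c * z x)) = 0" if "i < m" for i
  proof -
    have "(\<Sum>x<d. u i x * cnj (c * z x)) = cnj (\<Sum>x<d. c * z x * cnj (u i x))"
      by (simp add: mult_ac)
    then show ?thesis using cu[OF that] by simp
  qed
  have "orthonormal d (Suc m) (u(m := \<lambda>x. c * z x))"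
    unfolding orthonormal_def
  proof (intro allI impI)
    fix i j assume "i < Suc m" "j < Suc m"
    then consider "i < m" "j < m" | "i < m" "j = m" | "i = m" "j < m" | "i = m" "j = m"
      by linarith
    then show "(\<Sum>x<d. (u(m := \<lambda>x. c * z x)) i x * cnj ((u(m := \<lambda>x. c * z x)) j x))
        = (if i = j then 1 else 0)"
    proof cases
      case 1
      then show ?thesis using orthonormalD[OF u] by simp
    next
      case 2
      then show ?thesis using uc by simp
    next
      case 3
      then show ?thesis using cu by simp
    next
      case 4
      then show ?thesis using cc by simp
    qed
  qed
  then show ?thesis by (rule that)
qed

lemma orthonormal_extend_one:
  assumes "orthonormal d m u" "m < d"
  obtains z where "orthonormal d (Suc m) (u(m := z))"
proof -
  obtain z where z: "\<exists>y<d. z y \<noteq> 0" "\<And>i. i < m \<Longrightarrow> (\<Sum>y<d. cnj (u i y) * z y) = 0"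
    using exists_nontrivial_solution[OF assms(2), of "\<lambda>i y. cnj (u i y)"] by blast
  obtain c where "orthonormal d (Suc m) (u(m := \<lambda>x. c * z x))"
    by (rule orthonormal_append[OF assms(1) z(1)]) (use z(2) in \<open>simp_all add: mult.commute\<close>)
  then show ?thesis by (rule that)
qed

lemma orthonormal_extend:
  assumes "orthonormal d m u" "m \<le> d"
  obtains v where "orthonormal d d v" "\<And>i. i < m \<Longrightarrow> v i = u i"
proof -
  have "\<exists>v. orthonormal d n v \<and> (\<forall>i<m. v i = u i)" if "m \<le> n" "n \<le> d" for n
    using that
  proof (induction n rule: dec_induct)
    case base
    then show ?case using assms by blast
  next
    case (step n)
    then obtain v where v: "orthonormal d n v" "\<forall>i<m. v i = u i" by auto
    obtain z where "orthonormal d (Suc n) (v(n := z))"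
      using orthonormal_extend_one[OF v(1)] step by auto
    moreover have "\<forall>i<m. (v(n := z)) i = u i" using v(2) step by auto
    ultimately show ?case by blast
  qed
  then show ?thesis using assms(2) that by blast
qed

text \<open>The matrix with rows \<open>u i\<close> times its adjoint is the identity. For square
  matrices the product in the other order is then the identity as well, which is the resolution of
  the identity.\<close>

lemma orthonormal_complete:
  assumes "orthonormal d d u" "x < d" "y < d"
  shows "(\<Sum>i<d. u i x * cnj (u i y)) = (if x = y then 1 else 0)"
proof -
  define U where "U = mat d d (\<lambda>(i, x). u i x)"
  define V where "V = mat d d (\<lambda>(x, i). cnj (u i x))"
  have UV: "U \<in> carrier_mat d d" "V \<in> carrier_mat d d" by (auto simp: U_def V_def)
  have "U * V = 1\<^sub>m d"
    by (rule eq_matI)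
       (auto simp: U_def V_def scalar_prod_def orthonormalD[OF assms(1)] lessThan_atLeast0[symmetric])
  then have "V * U = 1\<^sub>m d" using mat_mult_left_right_inverse UV by blast
  then have "(V * U) $$ (y, x) = (if x = y then 1 else 0)" using assms(2,3) by auto
  moreover have "(V * U) $$ (y, x) = (\<Sum>i<d. u i x * cnj (u i y))"
    using assms(2,3) 
    by (auto simp: U_def V_def scalar_prod_def lessThan_atLeast0[symmetric] mult.commute)
  ultimately show ?thesis by simp
qed

lemma orthonormal_expand:
  assumes "orthonormal d d u" "x < d"
  shows "f x = (\<Sum>i<d. (\<Sum>y<d. f y * cnj (u i y)) * u i x)"
proof -
  have "(\<Sum>i<d. (\<Sum>y<d. f y * cnj (u i y)) * u i x)
      = (\<Sum>i<d. \<Sum>y<d. f y * (u i x * cnj (u i y)))"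
    by (simp add: sum_distrib_right sum_distrib_left mult_ac)
  also have "\<dots> = (\<Sum>y<d. f y * (\<Sum>i<d. u i x * cnj (u i y)))"
    by (subst sum.swap) (simp add: sum_distrib_left)
  also have "\<dots> = (\<Sum>y<d. if y = x then f y else 0)"
    using orthonormal_complete[OF assms(1)] assms(2) by (intro sum.cong) auto
  finally show ?thesis using assms(2) by (simp add: sum.delta)
qed

section \<open>Eigenbases of Hermitian kernels\<close>

lemma exists_eigenvector:
  fixes M :: "nat \<Rightarrow> nat \<Rightarrow> complex"
  assumes "n > 0"
  obtains \<mu> c where "\<exists>l<n. c l \<noteq> 0" "\<And>k. k < n \<Longrightarrow> (\<Sum>l<n. M k l * c l) = \<mu> * c k"
proof -
  define A where "A = mat n n (\<lambda>(k, l). M k l)"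
  have A: "A \<in> carrier_mat n n" by (simp add: A_def)
  have "degree (char_poly A) > 0" using degree_monic_char_poly[OF A] assms by simp
  then have "\<not> constant (poly (char_poly A))" by (simp add: constant_degree)
  then obtain \<mu> where "poly (char_poly A) \<mu> = 0"
    using fundamental_theorem_of_algebra by blast
  then have "eigenvalue A \<mu>" using eigenvalue_root_char_poly[OF A] by blast
  then obtain v where v: "v \<in> carrier_vec n" "v \<noteq> 0\<^sub>v n" "A *\<^sub>v v = \<mu> \<cdot>\<^sub>v v"
    using A unfolding eigenvalue_def eigenvector_def by auto
  show ?thesis
  proof
    show "\<exists>l<n. v $ l \<noteq> 0" using v(1,2) by (metis eq_vecI carrier_vecD index_zero_vec)
    fix k assume k: "k < n"
    have "(\<Sum>l<n. M k l * v $ l) = (A *\<^sub>v v) $ k"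
      using k v(1) by (simp add: A_def scalar_prod_def lessThan_atLeast0)
    then show "(\<Sum>l<n. M k l * v $ l) = \<mu> * v $ k" using v k by simp
  qed
qed

lemma hermitian_form_swap:
  fixes H :: "nat \<Rightarrow> nat \<Rightarrow> complex"
  assumes "\<And>x y. x < d \<Longrightarrow> y < d \<Longrightarrow> cnj (H x y) = H y x"
  shows "(\<Sum>x<d. (\<Sum>y<d. H x y * f y) * cnj (g x)) = (\<Sum>x<d. f x * cnj (\<Sum>y<d. H x y * g y))"
proof -
  have "(\<Sum>x<d. (\<Sum>y<d. H x y * f y) * cnj (g x)) = (\<Sum>x<d. \<Sum>y<d. H x y * f y * cnj (g x))"
    by (simp add: sum_distrib_right)
  also have "\<dots> = (\<Sum>y<d. \<Sum>x<d. H x y * f y * cnj (g x))" by (rule sum.swap)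
  also have "\<dots> = (\<Sum>y<d. \<Sum>x<d. f y * (cnj (H y x) * cnj (g x)))"
    using assms by (intro sum.cong) (auto simp: mult_ac)
  also have "\<dots> = (\<Sum>y<d. f y * cnj (\<Sum>x<d. H y x * g x))"
    by (simp add: sum_distrib_left)
  finally show ?thesis .
qed

text \<open>By Hermitian symmetry \<open>H\<close> preserves the orthogonal complement of the
  eigenvectors found so far. An eigenvector of the compression of \<open>H\<close> to this
  complement is therefore an eigenvector of \<open>H\<close>.\<close>

lemma hermitian_eigenbasis_extend:
  fixes H :: "nat \<Rightarrow> nat \<Rightarrow> complex"
  assumes H: "\<And>x y. x < d \<Longrightarrow> y < d \<Longrightarrow> cnj (H x y) = H y x"
    and u: "orthonormal d m u" "m < d"
    and eig: "\<And>i x. i < m \<Longrightarrow> x < d \<Longrightarrow> (\<Sum>y<d. H x y * u i y) = \<mu> i * u i x"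
  obtains z \<nu> where "orthonormal d (Suc m) (u(m := z))"
    "\<And>x. x < d \<Longrightarrow> (\<Sum>y<d. H x y * z y) = \<nu> * z x"
proof -
  obtain v where v: "orthonormal d d v" "\<And>i. i < m \<Longrightarrow> v i = u i"
    using orthonormal_extend[OF u(1)] u(2) by auto
  define n where "n = d - m"
  \<comment> \<open>\<open>M\<close> is the matrix of the compression in the basis
    \<open>v m\<close>, ..., \<open>v (d - 1)\<close>; its eigenvector \<open>c\<close> will hold
    the coordinates of \<open>z\<close>.\<close>
  define M where "M k l = (\<Sum>x<d. (\<Sum>y<d. H x y * v (m + l) y) * cnj (v (m + k) x))" for k l
  have n: "n > 0" "\<And>k. k < n \<Longrightarrow> m + k < d" using u(2) by (auto simp: n_def)
  obtain \<nu> c where c: "\<exists>l<n. c l \<noteq> 0" "\<And>k. k < n \<Longrightarrow> (\<Sum>l<n. M k l * c l) = \<nu> * c k"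
    by (rule exists_eigenvector[OF n(1), of M], rule that)
  define z where "z x = (\<Sum>l<n. c l * v (m + l) x)" for x
  have zv: "(\<Sum>x<d. z x * cnj (v i x)) = (if i < m then 0 else c (i - m))" if "i < d" for i
  proof -
    have "(\<Sum>x<d. z x * cnj (v i x)) = (\<Sum>x<d. \<Sum>l<n. c l * (v (m + l) x * cnj (v i x)))"
      by (simp add: z_def sum_distrib_right mult.assoc)
    also have "\<dots> = (\<Sum>l<n. c l * (\<Sum>x<d. v (m + l) x * cnj (v i x)))"
      by (subst sum.swap) (simp add: sum_distrib_left)
    also have "\<dots> = (\<Sum>l<n. if m + l = i then c l else 0)"
      using orthonormalD[OF v(1)] n(2) that by (intro sum.cong) auto
    also have "\<dots> = (if i < m then 0 else c (i - m))"
    proof (cases "i < m")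
      case False
      then have "m + l = i \<longleftrightarrow> l = i - m" for l by auto
      then show ?thesis using False that by (simp add: n_def)
    qed simp
    finally show ?thesis .
  qed
  \<comment> \<open>\<open>H z\<close> and \<open>\<nu> z\<close> are compared coordinatewise in the
    basis \<open>v\<close>: below \<open>m\<close> both coordinates vanish, from \<open>m\<close> on
    they agree by the eigenvector equation of \<open>M\<close>.\<close>
  have Hz: "(\<Sum>x<d. (\<Sum>y<d. H x y * z y) * cnj (v i x)) = \<nu> * (\<Sum>x<d. z x * cnj (v i x))"
    if "i < d" for i
  proof (cases "i < m")
    case True
    have "(\<Sum>x<d. (\<Sum>y<d. H x y * z y) * cnj (v i x)) = (\<Sum>x<d. z x * cnj (\<Sum>y<d. H x y * v i y))"
      by (rule hermitian_form_swap[OF H])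
    also have "\<dots> = (\<Sum>x<d. z x * cnj (\<mu> i * v i x))"
      using v(2) eig True by (intro sum.cong) auto
    also have "\<dots> = cnj (\<mu> i) * (\<Sum>x<d. z x * cnj (v i x))"
      by (simp add: sum_distrib_left mult_ac)
    finally show ?thesis using zv[OF that] True by simp
  next
    case False
    define k where "k = i - m"
    have k: "k < n" "i = m + k" using False that by (auto simp: n_def k_def)
    have "(\<Sum>y<d. H x y * z y) = (\<Sum>l<n. c l * (\<Sum>y<d. H x y * v (m + l) y))" for x
      unfolding z_def sum_distrib_left by (subst sum.swap) (simp add: mult_ac)
    then have "(\<Sum>x<d. (\<Sum>y<d. H x y * z y) * cnj (v i x))
        = (\<Sum>x<d. \<Sum>l<n. c l * ((\<Sum>y<d. H x y * v (m + l) y) * cnj (v i x)))"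
      by (simp add: sum_distrib_right mult.assoc)
    also have "\<dots> = (\<Sum>l<n. M k l * c l)"
      by (subst sum.swap) (simp add: M_def k sum_distrib_left mult.commute)
    also have "\<dots> = \<nu> * c k" using c(2) k by simp
    finally show ?thesis using zv[OF that] k by simp
  qed
  have z: "(\<Sum>y<d. H x y * z y) = \<nu> * z x" if "x < d" for x
  proof -
    have "(\<Sum>y<d. H x y * z y) = (\<Sum>i<d. (\<Sum>x<d. (\<Sum>y<d. H x y * z y) * cnj (v i x)) * v i x)"
      by (rule orthonormal_expand[OF v(1) that])
    also have "\<dots> = (\<Sum>i<d. \<nu> * ((\<Sum>x<d. z x * cnj (v i x)) * v i x))"
      using Hz by (intro sum.cong) auto
    also have "\<dots> = \<nu> * z x"
      using orthonormal_expand[OF v(1) that, of z] by (simp add: sum_distrib_left)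
    finally show ?thesis .
  qed
  have nz: "\<exists>x<d. z x \<noteq> 0"
  proof (rule ccontr)
    assume *: "\<not> (\<exists>x<d. z x \<noteq> 0)"
    obtain l where l: "l < n" "c l \<noteq> 0" using c(1) by blast
    have "(\<Sum>x<d. z x * cnj (v (m + l) x)) = 0" using * by simp
    then show False using zv[of "m + l"] n l by simp
  qed
  have zu: "(\<Sum>x<d. z x * cnj (u i x)) = 0" if "i < m" for i
    using zv[of i] v(2)[OF that] that u(2) by simp
  obtain e where e: "orthonormal d (Suc m) (u(m := \<lambda>x. e * z x))"
    by (rule orthonormal_append[OF u(1) nz zu])
  have "(\<Sum>y<d. H x y * (e * z y)) = \<nu> * (e * z x)" if "x < d" for x
  proof -
    have "(\<Sum>y<d. H x y * (e * z y)) = e * (\<Sum>y<d. H x y * z y)"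
      by (simp add: sum_distrib_left mult_ac)
    then show ?thesis using z[OF that] by simp
  qed
  with e show ?thesis by (rule that)
qed

lemma hermitian_eigenbasis:
  fixes H :: "nat \<Rightarrow> nat \<Rightarrow> complex"
  assumes H: "\<And>x y. x < d \<Longrightarrow> y < d \<Longrightarrow> cnj (H x y) = H y x"
  obtains u \<mu> where "orthonormal d d u"
    "\<And>i x. i < d \<Longrightarrow> x < d \<Longrightarrow> (\<Sum>y<d. H x y * u i y) = \<mu> i * u i x"
proof -
  have "\<exists>u \<mu>. orthonormal d m u \<and>
      (\<forall>i<m. \<forall>x<d. (\<Sum>y<d. H x y * u i y) = \<mu> i * u i x)" if "m \<le> d" for m
    using that
  proof (induction m)
    case 0
    then show ?case by (auto simp: orthonormal_def)
  next
    case (Suc m)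
    then obtain u \<mu> where u: "orthonormal d m u"
      "\<And>i x. i < m \<Longrightarrow> x < d \<Longrightarrow> (\<Sum>y<d. H x y * u i y) = \<mu> i * u i x" by auto
    obtain z \<nu> where z: "orthonormal d (Suc m) (u(m := z))"
      "\<And>x. x < d \<Longrightarrow> (\<Sum>y<d. H x y * z y) = \<nu> * z x"
      using hermitian_eigenbasis_extend[OF H u(1) _ u(2)] Suc.prems by auto
    have "\<forall>i<Suc m. \<forall>x<d. (\<Sum>y<d. H x y * (u(m := z)) i y) = (\<mu>(m := \<nu>)) i * (u(m := z)) i x"
      using u z by (auto simp: less_Suc_eq)
    with z(1) show ?case by blast
  qed
  then show ?thesis using that by blast
qed

section \<open>The spectral theorem in terms of \<open>eigenvalue_vec\<close>\<close>

lemma eigenvalue_vec_mset: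
  "mset (list_of_vec (eigenvalue_vec A)) = image_mset Re (proots (char_poly A))"
  by (simp add: eigenvalue_vec_def list_vec)

lemma eigenvalue_vec_antimono:
  assumes "i \<le> j" "j < dim_vec (eigenvalue_vec A)"
  shows "eigenvalue_vec A $ j \<le> eigenvalue_vec A $ i"
proof -
  define xs where "xs = sorted_list_of_multiset (image_mset Re (proots (char_poly A)))"
  have ev: "eigenvalue_vec A = vec_of_list (rev xs)" by (simp add: eigenvalue_vec_def xs_def)
  have "sorted xs" by (simp add: xs_def)
  then have "rev xs ! j \<le> rev xs ! i"
    using assms by (intro sorted_rev_nth_mono) (auto simp: ev)
  then show ?thesis by (simp add: ev vec_of_list_index)
qed

lemma hermitian_index:
  assumes "hermitian_mat A" "A \<in> carrier_mat d d" "x < d" "y < d"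
  shows "cnj (A $$ (x, y)) = A $$ (y, x)"
  using assms index_mat_adjoint[of y A x] by (auto simp: hermitian_mat_def)

lemma eigenbasis_representation:
  assumes "orthonormal d d v" "x < d" "y < d"
    and "\<And>i x. i < d \<Longrightarrow> x < d \<Longrightarrow> (\<Sum>y<d. H x y * v i y) = \<mu> i * v i x"
  shows "H x y = (\<Sum>i<d. \<mu> i * v i x * cnj (v i y))"
proof -
  have "H x y = (\<Sum>z<d. if z = y then H x z else 0)" using assms(3) by simp
  also have "\<dots> = (\<Sum>z<d. H x z * (\<Sum>i<d. v i z * cnj (v i y)))"
    using orthonormal_complete[OF assms(1)] assms(3) by (intro sum.cong) auto
  also have "\<dots> = (\<Sum>i<d. \<Sum>z<d. H x z * v i z * cnj (v i y))"
    unfolding sum_distrib_left by (subst sum.swap) (simp add: mult.assoc)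
  also have "\<dots> = (\<Sum>i<d. \<mu> i * v i x * cnj (v i y))"
    using assms(2,4) by (intro sum.cong) (auto simp flip: sum_distrib_right)
  finally show ?thesis .
qed

text \<open>\<open>eigenvalue_vec\<close> is defined through the characteristic polynomial. Unitary
  similarity to a diagonal matrix shows that the roots with multiplicity are the eigenvalues of an
  eigenbasis, which is then reordered to match the sorted list.\<close>

theorem hermitian_spectral:
  assumes herm: "hermitian_mat A" and A: "A \<in> carrier_mat d d"
  obtains u where "orthonormal d d u"
    "\<And>x y. x < d \<Longrightarrow> y < d \<Longrightarrow>
       A $$ (x, y) = (\<Sum>i<d. of_real (eigenvalue_vec A $ i) * u i x * cnj (u i y))"
proof -
  obtain v \<mu> where v: "orthonormal d d v"
    and eig: "\<And>i x. i < d \<Longrightarrow> x < d \<Longrightarrow> (\<Sum>y<d. A $$ (x, y) * v i y) = \<mu> i * v i x"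
    by (rule hermitian_eigenbasis[of d "\<lambda>x y. A $$ (x, y)"],
        rule hermitian_index[OF herm A], assumption, assumption, rule that)
  have rep: "A $$ (x, y) = (\<Sum>i<d. \<mu> i * v i x * cnj (v i y))" if "x < d" "y < d" for x y
    using eigenbasis_representation[OF v that, of "\<lambda>x y. A $$ (x, y)"] eig by blast
  define U where "U = mat d d (\<lambda>(x, i). v i x)"
  define V where "V = mat d d (\<lambda>(i, x). cnj (v i x))"
  define D where "D = mat d d (\<lambda>(i, j). if i = j then \<mu> i else 0)"
  have carr: "U \<in> carrier_mat d d" "V \<in> carrier_mat d d" "D \<in> carrier_mat d d"
    by (auto simp: U_def V_def D_def)
  have UV: "U * V = 1\<^sub>m d"
    by (rule eq_matI)
       (auto simp: U_def V_def scalar_prod_def orthonormal_complete[OF v] lessThan_atLeast0[symmetric])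
  have VU: "V * U = 1\<^sub>m d" using mat_mult_left_right_inverse[OF carr(1,2) UV] .
  have UD: "U * D = mat d d (\<lambda>(x, i). \<mu> i * v i x)"
  proof (rule eq_matI)
    fix x i assume "x < dim_row (mat d d (\<lambda>(x, i). \<mu> i * v i x))"
      "i < dim_col (mat d d (\<lambda>(x, i). \<mu> i * v i x))"
    then have xi: "x < d" "i < d" by auto
    then have "(U * D) $$ (x, i) = (\<Sum>k<d. v k x * (if k = i then \<mu> k else 0))"
      by (simp add: U_def D_def scalar_prod_def lessThan_atLeast0[symmetric])
    also have "\<dots> = (\<Sum>k<d. if k = i then \<mu> i * v i x else 0)" by (intro sum.cong) auto
    finally show "(U * D) $$ (x, i) = mat d d (\<lambda>(x, i). \<mu> i * v i x) $$ (x, i)" using xi by simp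
  qed (use carr in auto)
  have "A = U * D * V"
    unfolding UD
    by (rule eq_matI) (use A in \<open>auto simp: rep V_def scalar_prod_def lessThan_atLeast0[symmetric]\<close>)
  then have "similar_mat A D" using similar_matI[of A D U V d] A carr UV VU by auto
  then have "char_poly A = char_poly D" by (rule char_poly_similar)
  also have "\<dots> = (\<Prod>a\<leftarrow>diag_mat D. [:- a, 1:])"
    by (rule char_poly_upper_triangular[OF carr(3)]) (auto simp: D_def)
  also have "diag_mat D = map \<mu> [0..<d]"
    by (rule nth_equalityI) (auto simp: diag_mat_def D_def)
  finally have cp: "char_poly A = (\<Prod>a\<leftarrow>map \<mu> [0..<d]. [:- a, 1:])" .
  have roots: "proots (\<Prod>a\<leftarrow>xs. [:- a, 1:]) = mset xs" for xs :: "complex list"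
  proof (induction xs)
    case (Cons a xs)
    have "(\<Prod>a\<leftarrow>xs. [:- a, 1:]) \<noteq> 0" by (auto simp: prod_list_zero_iff)
    then show ?case using Cons proots_mult[of "[:- a, 1:]"] by (simp del: mult_pCons_left)
  qed simp
  have pr: "proots (char_poly A) = mset (map \<mu> [0..<d])" unfolding cp roots ..
  have \<mu>: "\<mu> i = of_real (Re (\<mu> i))" if "i < d" for i
    using hermitian_eigenvalue_real[OF herm, of "\<mu> i"] that by (auto simp: pr)
  have "mset (list_of_vec (eigenvalue_vec A)) = mset (map (\<lambda>i. Re (\<mu> i)) [0..<d])"
    unfolding eigenvalue_vec_mset pr by (simp add: multiset.map_comp comp_def)
  \<comment> \<open>Both lists carry the same multiset, so sorting is a permutation
    \<open>p\<close>, and \<open>v (p i)\<close> is the reordered basis.\<close>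
  then obtain p where p: "p permutes {..<length (map (\<lambda>i. Re (\<mu> i)) [0..<d])}"
    "permute_list p (map (\<lambda>i. Re (\<mu> i)) [0..<d]) = list_of_vec (eigenvalue_vec A)"
    by (rule mset_eq_permutation)
  have perm: "p permutes {..<d}" using p(1) by simp
  have pd: "p i < d" if "i < d" for i using permutes_in_image[OF perm, of i] that by auto
  have ev: "eigenvalue_vec A $ i = Re (\<mu> (p i))" if "i < d" for i
  proof -
    have "eigenvalue_vec A $ i = list_of_vec (eigenvalue_vec A) ! i"
      using eigenvalue_vec_carrier[OF A] that by (simp add: list_of_vec_index)
    also have "\<dots> = Re (\<mu> (p i))"
      unfolding p(2)[symmetric] using p(1) that pd by (simp add: permute_list_nth)
    finally show ?thesis .
  qed
  show ?thesis
  proof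
    show "orthonormal d d (\<lambda>i. v (p i))"
      unfolding orthonormal_def using orthonormalD[OF v] pd permutes_inj[OF perm]
      by (auto simp: inj_eq)
    fix x y assume xy: "x < d" "y < d"
    have "A $$ (x, y) = (\<Sum>i<d. \<mu> (p i) * v (p i) x * cnj (v (p i) y))"
      unfolding rep[OF xy] by (subst sum.permute[OF perm]) (simp add: comp_def)
    then show "A $$ (x, y) = (\<Sum>i<d. of_real (eigenvalue_vec A $ i) * v (p i) x * cnj (v (p i) y))"
      using ev \<mu> pd by simp
  qed
qed

lemma cmod_sum_square:
  "complex_of_real ((cmod (\<Sum>x\<in>I. f x * z x))\<^sup>2) =
     (\<Sum>x\<in>I. \<Sum>y\<in>I. z x * cnj (z y) * (f x * cnj (f y)))"
  by (simp only: complex_norm_square cnj_sum sum_product complex_cnj_mult) (simp add: mult_ac)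

text \<open>After expanding the squares, the sum over \<open>i\<close> is the kernel evaluated by
  \<open>orthonormal_complete\<close>. The pairing is bilinear, which is why basis vectors are
  conjugated when they appear as arguments later.\<close>

lemma parseval:
  assumes "orthonormal d d u"
  shows "(\<Sum>i<d. (cmod (\<Sum>x<d. u i x * z x))\<^sup>2) = (\<Sum>x<d. (cmod (z x))\<^sup>2)"
proof -
  have "complex_of_real (\<Sum>i<d. (cmod (\<Sum>x<d. u i x * z x))\<^sup>2)
      = (\<Sum>i<d. \<Sum>x<d. \<Sum>y<d. z x * cnj (z y) * (u i x * cnj (u i y)))"
    by (simp only: of_real_sum cmod_sum_square)
  also have "\<dots> = (\<Sum>x<d. \<Sum>y<d. z x * cnj (z y) * (\<Sum>i<d. u i x * cnj (u i y)))"
    unfolding sum_distrib_left by (subst sum.swap, rule sum.cong[OF refl], rule sum.swap)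
  also have "\<dots> = (\<Sum>x<d. \<Sum>y<d. if x = y then z x * cnj (z y) else 0)"
    using orthonormal_complete[OF assms] by (intro sum.cong) auto
  also have "\<dots> = complex_of_real (\<Sum>x<d. (cmod (z x))\<^sup>2)"
    by (simp add: sum_cnj_self)
  finally show ?thesis by (simp only: of_real_eq_iff)
qed

section \<open>Bessel families\<close>

text \<open>The pairing is bilinear rather than sesquilinear; as \<open>z\<close> is arbitrary this makes no
  difference, and \<open>bessel\<close> says that the operator \<open>\<Sum>\<^sub>k u\<^sub>k u\<^sub>k\<^sup>*\<close> is a contraction.\<close>

definition bessel :: "'i set \<Rightarrow> 'k set \<Rightarrow> ('k \<Rightarrow> 'i \<Rightarrow> complex) \<Rightarrow> bool" where
  "bessel I K u \<longleftrightarrow>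
     (\<forall>z. (\<Sum>k\<in>K. (cmod (\<Sum>x\<in>I. u k x * z x))\<^sup>2) \<le> (\<Sum>x\<in>I. (cmod (z x))\<^sup>2))"

lemma besselD:
  "bessel I K u \<Longrightarrow> (\<Sum>k\<in>K. (cmod (\<Sum>x\<in>I. u k x * z x))\<^sup>2) \<le> (\<Sum>x\<in>I. (cmod (z x))\<^sup>2)"
  by (simp add: bessel_def)

lemma bessel_cnj:
  assumes "bessel I K u"
  shows "bessel I K (\<lambda>k x. cnj (u k x))"
  unfolding bessel_def
proof
  fix z
  have "cmod (\<Sum>x\<in>I. cnj (u k x) * z x) = cmod (\<Sum>x\<in>I. u k x * cnj (z x))" for k
    by (subst complex_mod_cnj[symmetric]) simp
  then show "(\<Sum>k\<in>K. (cmod (\<Sum>x\<in>I. cnj (u k x) * z x))\<^sup>2) \<le> (\<Sum>x\<in>I. (cmod (z x))\<^sup>2)"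
    using besselD[OF assms, of "\<lambda>x. cnj (z x)"] by simp
qed

lemma bessel_subset:
  assumes "bessel I K u" "K' \<subseteq> K" "finite K"
  shows "bessel I K' u"
  unfolding bessel_def
proof
  fix z
  have "(\<Sum>k\<in>K'. (cmod (\<Sum>x\<in>I. u k x * z x))\<^sup>2) \<le> (\<Sum>k\<in>K. (cmod (\<Sum>x\<in>I. u k x * z x))\<^sup>2)"
    using assms by (intro sum_mono2) auto
  also have "\<dots> \<le> (\<Sum>x\<in>I. (cmod (z x))\<^sup>2)" by (rule besselD[OF assms(1)])
  finally show "(\<Sum>k\<in>K'. (cmod (\<Sum>x\<in>I. u k x * z x))\<^sup>2) \<le> (\<Sum>x\<in>I. (cmod (z x))\<^sup>2)" .
qed

text \<open>Testing the Bessel inequality on the conjugate of \<open>u k\<close> and keeping only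
  the term of \<open>k\<close> gives S^2 <= S for the squared norm S.\<close>

lemma bessel_norm_le:
  assumes "bessel I K u" "finite K" "k \<in> K"
  shows "(\<Sum>x\<in>I. (cmod (u k x))\<^sup>2) \<le> 1"
proof -
  define S where "S = (\<Sum>x\<in>I. (cmod (u k x))\<^sup>2)"
  have "(\<Sum>x\<in>I. u k x * cnj (u k x)) = of_real S"
    by (simp only: S_def of_real_sum complex_norm_square)
  then have "S\<^sup>2 = (cmod (\<Sum>x\<in>I. u k x * cnj (u k x)))\<^sup>2" by simp
  also have "\<dots> \<le> (\<Sum>k'\<in>K. (cmod (\<Sum>x\<in>I. u k' x * cnj (u k x)))\<^sup>2)"
    using assms(2,3) by (intro member_le_sum) auto
  also have "\<dots> \<le> (\<Sum>x\<in>I. (cmod (cnj (u k x)))\<^sup>2)" by (rule besselD[OF assms(1)])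
  finally have "S * S \<le> S" by (simp add: S_def power2_eq_square)
  have "S \<le> 1"
  proof (rule ccontr)
    assume "\<not> S \<le> 1"
    then have "S * 1 < S * S" by (intro mult_strict_left_mono) auto
    with \<open>S * S \<le> S\<close> show False by simp
  qed
  then show ?thesis by (simp add: S_def)
qed

lemma bessel_orthogonal:
  assumes "finite I" "finite K"
    and orth: "\<And>i j. i \<in> K \<Longrightarrow> j \<in> K \<Longrightarrow> i \<noteq> j \<Longrightarrow> (\<Sum>x\<in>I. u i x * cnj (u j x)) = 0"
    and norm: "\<And>i. i \<in> K \<Longrightarrow> (\<Sum>x\<in>I. (cmod (u i x))\<^sup>2) \<le> 1"
  shows "bessel I K u"
  unfolding bessel_def
proof
  fix z
  define c where "c i = (\<Sum>x\<in>I. u i x * z x)" for i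
  define p where "p x = (\<Sum>i\<in>K. c i * cnj (u i x))" for x
  define C where "C = (\<Sum>i\<in>K. (cmod (c i))\<^sup>2)"
  have zp: "(\<Sum>x\<in>I. z x * cnj (p x)) = of_real C"
  proof -
    have "(\<Sum>x\<in>I. z x * cnj (p x)) = (\<Sum>x\<in>I. \<Sum>i\<in>K. cnj (c i) * (u i x * z x))"
      by (simp add: p_def sum_distrib_left mult_ac)
    also have "\<dots> = (\<Sum>i\<in>K. cnj (c i) * c i)"
      by (subst sum.swap) (simp add: c_def sum_distrib_left)
    also have "\<dots> = of_real C" 
      by (simp only: C_def of_real_sum complex_norm_square mult.commute)
    finally show ?thesis .
  qed
  have pp: "(\<Sum>x\<in>I. (cmod (p x))\<^sup>2) \<le> C"
  proof -
    have "complex_of_real (\<Sum>x\<in>I. (cmod (p x))\<^sup>2) = (\<Sum>x\<in>I. \<Sum>i\<in>K. \<Sum>j\<in>K. cnj (c i) * c j * (u i x * cnj (u j x)))"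
      unfolding p_def
      by (simp only: of_real_sum complex_norm_square cnj_sum sum_product complex_cnj_mult complex_cnj_cnj)
         (subst sum.swap, simp add: mult_ac)
    also have "\<dots> = (\<Sum>i\<in>K. \<Sum>j\<in>K. cnj (c i) * c j * (\<Sum>x\<in>I. u i x * cnj (u j x)))"
      unfolding sum_distrib_left by (subst sum.swap, rule sum.cong[OF refl], rule sum.swap)
    also have "\<dots> = (\<Sum>i\<in>K. \<Sum>j\<in>K. if i = j then cnj (c i) * c i * (\<Sum>x\<in>I. u i x * cnj (u i x)) else 0)"
      using orth by (intro sum.cong) auto
    also have "\<dots> = (\<Sum>i\<in>K. cnj (c i) * c i * (\<Sum>x\<in>I. u i x * cnj (u i x)))"
      using assms(2) by (intro sum.cong) auto
    also have "\<dots> = complex_of_real (\<Sum>i\<in>K. (cmod (c i))\<^sup>2 * (\<Sum>x\<in>I. (cmod (u i x))\<^sup>2))"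
      by (simp only: of_real_sum of_real_mult complex_norm_square mult.commute[of "cnj (c _)"])
    finally have "(\<Sum>x\<in>I. (cmod (p x))\<^sup>2) = (\<Sum>i\<in>K. (cmod (c i))\<^sup>2 * (\<Sum>x\<in>I. (cmod (u i x))\<^sup>2))"
      by (simp only: of_real_eq_iff)
    also have "\<dots> \<le> (\<Sum>i\<in>K. (cmod (c i))\<^sup>2 * 1)"
      using norm by (intro sum_mono mult_left_mono) auto
    finally show ?thesis by (simp add: C_def)
  qed
  have cm: "(cmod (a - b))\<^sup>2 = (cmod a)\<^sup>2 - 2 * Re (a * cnj b) + (cmod b)\<^sup>2" for a b
    by (simp only: cmod_power2) (simp add: power2_eq_square algebra_simps)
  have "0 \<le> (\<Sum>x\<in>I. (cmod (z x - p x))\<^sup>2)" by (intro sum_nonneg) auto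
  also have "\<dots> = (\<Sum>x\<in>I. (cmod (z x))\<^sup>2) - 2 * Re (\<Sum>x\<in>I. z x * cnj (p x)) + (\<Sum>x\<in>I. (cmod (p x))\<^sup>2)"
    unfolding cm by (simp add: sum.distrib sum_subtractf sum_distrib_left)
  also have "\<dots> \<le> (\<Sum>x\<in>I. (cmod (z x))\<^sup>2) - C" using pp by (simp add: zp)
  finally show "(\<Sum>k\<in>K. (cmod (\<Sum>x\<in>I. u k x * z x))\<^sup>2) \<le> (\<Sum>x\<in>I. (cmod (z x))\<^sup>2)"
    by (simp add: C_def c_def)
qed

lemma orthonormal_norm:
  assumes "orthonormal d m u" "i < m"
  shows "(\<Sum>x<d. (cmod (u i x))\<^sup>2) = 1"
proof -
  have "complex_of_real (\<Sum>x<d. (cmod (u i x))\<^sup>2) = of_real 1"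
    using orthonormalD[OF assms(1), of i i] assms(2) by (simp add: sum_cnj_self)
  then show ?thesis by (simp only: of_real_eq_iff)
qed

lemma orthonormal_bessel:
  assumes "orthonormal d m u"
  shows "bessel {..<d} {..<m} u"
  by (rule bessel_orthogonal) (use orthonormalD[OF assms] orthonormal_norm[OF assms] in auto)

section \<open>Majorization inequalities for weights\<close>

text \<open>The lower bound carries the last value of \<open>\<alpha>\<close> for the sake of the
  induction: passing to the next, smaller value only lowers its product with a nonnegative partial
  sum.\<close>

lemma abel_nonneg:
  fixes \<alpha> g :: "nat \<Rightarrow> real"
  assumes "\<And>i j. i \<le> j \<Longrightarrow> j \<le> n \<Longrightarrow> \<alpha> j \<le> \<alpha> i" "\<And>r. r \<le> Suc n \<Longrightarrow> 0 \<le> (\<Sum>i<r. g i)"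
  shows "\<alpha> n * (\<Sum>i<Suc n. g i) \<le> (\<Sum>i<Suc n. \<alpha> i * g i)"
  using assms
proof (induction n)
  case (Suc n)
  have "\<alpha> (Suc n) * (\<Sum>i<Suc n. g i) \<le> \<alpha> n * (\<Sum>i<Suc n. g i)"
    using Suc.prems(1)[of n "Suc n"] Suc.prems(2)[of "Suc n"] by (intro mult_right_mono) auto
  also have "\<dots> \<le> (\<Sum>i<Suc n. \<alpha> i * g i)" using Suc by auto
  finally show ?case
    by (subst (1 2) sum.lessThan_Suc) (simp only: distrib_left add_right_mono)
qed simp

text \<open>\<open>abel_nonneg\<close> for \<open>h - f\<close>; its lower bound is nonnegative as
  the last value of \<open>\<alpha>\<close> is.\<close>

lemma abel_le:
  fixes \<alpha> f h :: "nat \<Rightarrow> real"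
  assumes "\<And>i j. i \<le> j \<Longrightarrow> j < n \<Longrightarrow> \<alpha> j \<le> \<alpha> i" "\<And>i. i < n \<Longrightarrow> 0 \<le> \<alpha> i"
    and "\<And>r. r \<le> n \<Longrightarrow> (\<Sum>i<r. f i) \<le> (\<Sum>i<r. h i)"
  shows "(\<Sum>i<n. \<alpha> i * f i) \<le> (\<Sum>i<n. \<alpha> i * h i)"
proof (cases n)
  case (Suc k)
  have "0 \<le> \<alpha> k * (\<Sum>i<Suc k. h i - f i)"
    using assms(2)[of k] assms(3)[of "Suc k"] by (intro mult_nonneg_nonneg) (auto simp: sum_subtractf Suc)
  also have "\<dots> \<le> (\<Sum>i<Suc k. \<alpha> i * (h i - f i))"
    by (rule abel_nonneg) (use assms(1,3) Suc in \<open>auto simp: sum_subtractf\<close>)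
  also have "\<dots> = (\<Sum>i<n. \<alpha> i * h i) - (\<Sum>i<n. \<alpha> i * f i)"
    by (simp add: Suc right_diff_distrib sum_subtractf)
  finally show ?thesis by simp
qed simp

text \<open>Abel summation in \<open>j\<close> for each fixed number \<open>r\<close> of rows, then
  in \<open>i\<close>; the partial sums met in this way are exactly the corner sums.\<close>

lemma abel_rectangle_le:
  fixes \<alpha> \<beta> :: "nat \<Rightarrow> real" and g h :: "nat \<Rightarrow> nat \<Rightarrow> real"
  assumes \<alpha>: "\<And>i j. i \<le> j \<Longrightarrow> j < m \<Longrightarrow> \<alpha> j \<le> \<alpha> i" "\<And>i. i < m \<Longrightarrow> 0 \<le> \<alpha> i"
    and \<beta>: "\<And>i j. i \<le> j \<Longrightarrow> j < n \<Longrightarrow> \<beta> j \<le> \<beta> i" "\<And>i. i < n \<Longrightarrow> 0 \<le> \<beta> i"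
    and le: "\<And>r s. r \<le> m \<Longrightarrow> s \<le> n \<Longrightarrow> (\<Sum>i<r. \<Sum>j<s. g i j) \<le> (\<Sum>i<r. \<Sum>j<s. h i j)"
  shows "(\<Sum>i<m. \<Sum>j<n. \<alpha> i * \<beta> j * g i j) \<le> (\<Sum>i<m. \<Sum>j<n. \<alpha> i * \<beta> j * h i j)"
proof -
  have "(\<Sum>i<m. \<alpha> i * (\<Sum>j<n. \<beta> j * g i j)) \<le> (\<Sum>i<m. \<alpha> i * (\<Sum>j<n. \<beta> j * h i j))"
  proof (rule abel_le[OF \<alpha>])
    fix r assume r: "r \<le> m"
    have "(\<Sum>j<n. \<beta> j * (\<Sum>i<r. g i j)) \<le> (\<Sum>j<n. \<beta> j * (\<Sum>i<r. h i j))"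
    proof (rule abel_le[OF \<beta>])
      show "(\<Sum>j<s. \<Sum>i<r. g i j) \<le> (\<Sum>j<s. \<Sum>i<r. h i j)" if "s \<le> n" for s
        using le[OF r that] by (subst (1 2) sum.swap)
    qed
    then show "(\<Sum>i<r. \<Sum>j<n. \<beta> j * g i j) \<le> (\<Sum>i<r. \<Sum>j<n. \<beta> j * h i j)"
      unfolding sum_distrib_left by (subst (1 2) sum.swap)
  qed
  then show ?thesis by (simp add: sum_distrib_left mult.assoc)
qed

text \<open>The partial sums of \<open>w\<close> are at most \<open>min r s\<close>, which is the
  partial sum of the indicator \<open>h\<close> of the first \<open>s\<close> indices; Abel
  summation does the rest.\<close>

lemma weighted_sum_le_top:
  fixes \<xi> w :: "nat \<Rightarrow> real"
  assumes \<xi>: "\<And>i j. i \<le> j \<Longrightarrow> j < n \<Longrightarrow> \<xi> j \<le> \<xi> i" "\<And>i. i < n \<Longrightarrow> 0 \<le> \<xi> i"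
    and w: "\<And>i. i < n \<Longrightarrow> 0 \<le> w i" "\<And>i. i < n \<Longrightarrow> w i \<le> 1" "(\<Sum>i<n. w i) \<le> real s"
    and "s \<le> n"
  shows "(\<Sum>i<n. \<xi> i * w i) \<le> (\<Sum>i<s. \<xi> i)"
proof -
  define h where "h i = (if i < s then 1 else 0 :: real)" for i
  have h: "(\<Sum>i<r. h i) = real (min r s)" for r
  proof -
    have "(\<Sum>i<r. h i) = (\<Sum>i\<in>{..<r} \<inter> {..<s}. 1)"
      unfolding h_def by (subst sum.inter_restrict) auto
    also have "{..<r} \<inter> {..<s} = {..<min r s}" by auto
    finally show ?thesis by simp
  qed
  have "(\<Sum>i<n. \<xi> i * w i) \<le> (\<Sum>i<n. \<xi> i * h i)"
  proof (rule abel_le)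
    fix r assume r: "r \<le> n"
    have "(\<Sum>i<r. w i) \<le> (\<Sum>i<n. w i)" using w(1) r by (intro sum_mono2) auto
    moreover have "(\<Sum>i<r. w i) \<le> (\<Sum>i<r. 1)" using w(2) r by (intro sum_mono) auto
    ultimately show "(\<Sum>i<r. w i) \<le> (\<Sum>i<r. h i)" using w(3) by (simp add: h)
  qed (use \<xi> in auto)
  also have "\<dots> = (\<Sum>i\<in>{..<n} \<inter> {..<s}. \<xi> i)"
    unfolding h_def by (subst sum.inter_restrict) (auto intro!: sum.cong)
  also have "{..<n} \<inter> {..<s} = {..<s}" using \<open>s \<le> n\<close> by auto
  finally show ?thesis .
qed

section \<open>Quadratic forms: diagonalization, Weyl monotonicity, Ky Fan inequality\<close>

lemma quadratic_form_diagonalization: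
  fixes M :: "'t \<Rightarrow> nat \<Rightarrow> complex"
  assumes "finite T"
  obtains c \<xi> where "orthonormal d d c"
    "\<And>i j. i \<le> j \<Longrightarrow> j < d \<Longrightarrow> \<xi> j \<le> \<xi> i"
    "\<And>b. (\<Sum>t\<in>T. (cmod (\<Sum>y<d. M t y * b y))\<^sup>2) = (\<Sum>j<d. \<xi> j * (cmod (\<Sum>y<d. c j y * b y))\<^sup>2)"
proof -
  \<comment> \<open>The sum of squares is the quadratic form of this Hermitian matrix, so its
    spectral decomposition diagonalizes the form with decreasing coefficients.\<close>
  define A where "A = mat d d (\<lambda>(y, y'). \<Sum>t\<in>T. M t y * cnj (M t y'))"
  have A: "A \<in> carrier_mat d d" by (simp add: A_def)
  have "mat_adjoint A = A"
    by (rule eq_matI) (auto simp: A_def index_mat_adjoint mult.commute)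
  then have herm: "hermitian_mat A" using A by (auto simp: hermitian_mat_def)
  obtain c where c: "orthonormal d d c"
    "\<And>x y. x < d \<Longrightarrow> y < d \<Longrightarrow>
       A $$ (x, y) = (\<Sum>i<d. of_real (eigenvalue_vec A $ i) * c i x * cnj (c i y))"
    by (rule hermitian_spectral[OF herm A], rule that)
  show ?thesis
  proof (rule that[OF c(1)])
    fix i j assume "i \<le> j" "j < d"
    then show "eigenvalue_vec A $ j \<le> eigenvalue_vec A $ i"
      using eigenvalue_vec_antimono[of i j A] eigenvalue_vec_carrier[OF A] by auto
  next
    fix b
    have "complex_of_real (\<Sum>t\<in>T. (cmod (\<Sum>y<d. M t y * b y))\<^sup>2)
        = (\<Sum>t\<in>T. \<Sum>y<d. \<Sum>y'<d. b y * cnj (b y') * (M t y * cnj (M t y')))"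
      by (simp only: of_real_sum cmod_sum_square)
    also have "\<dots> = (\<Sum>y<d. \<Sum>y'<d. b y * cnj (b y') * (\<Sum>t\<in>T. M t y * cnj (M t y')))"
      unfolding sum_distrib_left by (subst sum.swap, rule sum.cong[OF refl], rule sum.swap)
    also have "\<dots> = (\<Sum>y<d. \<Sum>y'<d. b y * cnj (b y') * A $$ (y, y'))"
      by (simp add: A_def)
    also have "\<dots> = (\<Sum>y<d. \<Sum>y'<d. \<Sum>i<d.
        of_real (eigenvalue_vec A $ i) * (b y * cnj (b y') * (c i y * cnj (c i y'))))"
      by (intro sum.cong refl) (simp add: c(2) sum_distrib_left mult_ac)
    also have "\<dots> = (\<Sum>i<d. of_real (eigenvalue_vec A $ i) *
        (\<Sum>y<d. \<Sum>y'<d. b y * cnj (b y') * (c i y * cnj (c i y'))))"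
      unfolding sum_distrib_left
      by (subst (2) sum.swap, subst sum.swap, rule sum.cong[OF refl], rule sum.cong[OF refl], rule refl)
    also have "\<dots> = complex_of_real (\<Sum>i<d. eigenvalue_vec A $ i * (cmod (\<Sum>y<d. c i y * b y))\<^sup>2)"
      by (simp only: of_real_sum of_real_mult cmod_sum_square)
    finally show "(\<Sum>t\<in>T. (cmod (\<Sum>y<d. M t y * b y))\<^sup>2)
        = (\<Sum>j<d. eigenvalue_vec A $ j * (cmod (\<Sum>y<d. c j y * b y))\<^sup>2)"
      by (simp only: of_real_eq_iff)
  qed
qed

text \<open>On a nonzero vector that pairs to zero with \<open>e i\<close> for \<open>i < k\<close>
  and with \<open>c i\<close> for \<open>i > k\<close>, the first form is at least
  \<open>\<xi> k\<close> and the second at most \<open>\<rho> k\<close> times the squared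
  norm.\<close>

lemma weyl_monotonicity:
  fixes \<xi> \<rho> :: "nat \<Rightarrow> real"
  assumes c: "orthonormal d d c" and e: "orthonormal d d e"
    and \<xi>: "\<And>i j. i \<le> j \<Longrightarrow> j < d \<Longrightarrow> \<xi> j \<le> \<xi> i"
    and \<rho>: "\<And>i j. i \<le> j \<Longrightarrow> j < d \<Longrightarrow> \<rho> j \<le> \<rho> i"
    and le: "\<And>b. (\<Sum>j<d. \<xi> j * (cmod (\<Sum>y<d. c j y * b y))\<^sup>2)
      \<le> (\<Sum>j<d. \<rho> j * (cmod (\<Sum>y<d. e j y * b y))\<^sup>2)"
    and k: "k < d"
  shows "\<xi> k \<le> \<rho> k"
proof -
  have d: "d - 1 < d" using k by simp
  \<comment> \<open>These are \<open>d - 1\<close> equations in \<open>d\<close> unknowns. The shift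
    to \<open>Suc i\<close> leaves out \<open>c k\<close>, the one vector on which no condition is
    imposed.\<close>
  obtain z where nz: "\<exists>y<d. z y \<noteq> 0" and z: "\<And>i. i < d - 1 \<Longrightarrow>
      (\<Sum>y<d. (if i < k then e i y else c (Suc i) y) * z y) = 0"
    by (rule exists_nontrivial_solution[OF d, where M = "\<lambda>i y. if i < k then e i y else c (Suc i) y"], rule that)
  have ze: "(\<Sum>y<d. e i y * z y) = 0" if "i < k" for i
    using z[of i] that k by simp
  have zc: "(\<Sum>y<d. c i y * z y) = 0" if "k < i" "i < d" for i
    using z[of "i - 1"] that by (cases i) auto
  define N where "N = (\<Sum>x<d. (cmod (z x))\<^sup>2)"
  have "N > 0" unfolding N_def using nz by (auto intro!: sum_pos2)
  have "\<xi> k * N = (\<Sum>j<d. \<xi> k * (cmod (\<Sum>y<d. c j y * z y))\<^sup>2)"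
    by (simp only: N_def parseval[OF c] flip: sum_distrib_left)
  also have "\<dots> \<le> (\<Sum>j<d. \<xi> j * (cmod (\<Sum>y<d. c j y * z y))\<^sup>2)"
  proof (rule sum_mono)
    fix j assume "j \<in> {..<d}"
    then show "\<xi> k * (cmod (\<Sum>y<d. c j y * z y))\<^sup>2 \<le> \<xi> j * (cmod (\<Sum>y<d. c j y * z y))\<^sup>2"
      using \<xi>[of j k] k zc[of j] by (cases "j \<le> k") (auto intro: mult_right_mono)
  qed
  also have "\<dots> \<le> (\<Sum>j<d. \<rho> j * (cmod (\<Sum>y<d. e j y * z y))\<^sup>2)" by (rule le)
  also have "\<dots> \<le> (\<Sum>j<d. \<rho> k * (cmod (\<Sum>y<d. e j y * z y))\<^sup>2)"
  proof (rule sum_mono)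
    fix j assume "j \<in> {..<d}"
    then show "\<rho> j * (cmod (\<Sum>y<d. e j y * z y))\<^sup>2 \<le> \<rho> k * (cmod (\<Sum>y<d. e j y * z y))\<^sup>2"
      using \<rho>[of k j] k ze[of j] by (cases "k \<le> j") (auto intro: mult_right_mono)
  qed
  also have "\<dots> = \<rho> k * N"
    by (simp only: N_def parseval[OF e] flip: sum_distrib_left)
  finally show ?thesis using \<open>N > 0\<close> by simp
qed

lemma orthonormal_form_at_cnj:
  fixes \<xi> :: "nat \<Rightarrow> real"
  assumes "orthonormal d d c" "k < d"
  shows "(\<Sum>j<d. \<xi> j * (cmod (\<Sum>y<d. c j y * cnj (c k y)))\<^sup>2) = \<xi> k"
proof -
  have "(\<Sum>j<d. \<xi> j * (cmod (\<Sum>y<d. c j y * cnj (c k y)))\<^sup>2) = (\<Sum>j<d. if j = k then \<xi> j else 0)"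
    using orthonormalD[OF assms(1)] assms(2) by (intro sum.cong) auto
  then show ?thesis using assms(2) by simp
qed

text \<open>Ky Fan's inequality. Exchanging the sums gives weights \<open>w m\<close> on the
  eigenvalues: they are at most 1 by the Bessel inequality of \<open>b\<close> tested on
  \<open>c m\<close>, and their total is at most \<open>s\<close> by Parseval and the norm bound on
  \<open>b j\<close>.\<close>

lemma bessel_form_le_top:
  fixes \<xi> :: "nat \<Rightarrow> real"
  assumes c: "orthonormal d d c" and \<xi>: "\<And>i j. i \<le> j \<Longrightarrow> j < d \<Longrightarrow> \<xi> j \<le> \<xi> i"
    "\<And>i. i < d \<Longrightarrow> 0 \<le> \<xi> i"
    and b: "bessel {..<d} {..<s} b" and s: "s \<le> d"
  shows "(\<Sum>j<s. \<Sum>m<d. \<xi> m * (cmod (\<Sum>y<d. c m y * b j y))\<^sup>2) \<le> (\<Sum>m<s. \<xi> m)"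
proof -
  define w where "w m = (\<Sum>j<s. (cmod (\<Sum>y<d. c m y * b j y))\<^sup>2)" for m
  have "(\<Sum>j<s. \<Sum>m<d. \<xi> m * (cmod (\<Sum>y<d. c m y * b j y))\<^sup>2) = (\<Sum>m<d. \<xi> m * w m)"
    unfolding w_def sum_distrib_left by (rule sum.swap)
  also have "\<dots> \<le> (\<Sum>m<s. \<xi> m)"
  proof (rule weighted_sum_le_top)
    fix m assume m: "m < d"
    show "0 \<le> w m" by (simp add: w_def sum_nonneg)
    have "w m = (\<Sum>j<s. (cmod (\<Sum>y<d. b j y * c m y))\<^sup>2)" by (simp add: w_def mult.commute)
    also have "\<dots> \<le> (\<Sum>y<d. (cmod (c m y))\<^sup>2)" by (rule besselD[OF b])
    also have "\<dots> = 1" using orthonormal_norm[OF c m] .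
    finally show "w m \<le> 1" .
  next
    have "(\<Sum>m<d. w m) = (\<Sum>j<s. \<Sum>m<d. (cmod (\<Sum>y<d. c m y * b j y))\<^sup>2)"
      unfolding w_def by (rule sum.swap)
    also have "\<dots> = (\<Sum>j<s. \<Sum>y<d. (cmod (b j y))\<^sup>2)" by (simp add: parseval[OF c])
    also have "\<dots> \<le> (\<Sum>j<s. 1)"
      using bessel_norm_le[OF b] by (intro sum_mono) auto
    finally show "(\<Sum>m<d. w m) \<le> real s" by simp
  qed (use \<xi> s in auto)
  finally show ?thesis .
qed

section \<open>The weight of a Bessel family on a tensor product\<close>

text \<open>The quantity g(i, j) of the overview for one product vector, with the bilinear pairing;
  the tensor product is indexed by pairs here rather than by encoded numbers.\<close>

definition overlap ::
  "nat \<Rightarrow> nat \<Rightarrow> 'p set \<Rightarrow> ('p \<Rightarrow> nat \<times> nat \<Rightarrow> complex) \<Rightarrow> (nat \<Rightarrow> complex) \<Rightarrow> (nat \<Rightarrow> complex) \<Rightarrow> real"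
  where "overlap d1 d2 P w a b =
    (\<Sum>p\<in>P. (cmod (\<Sum>(x, y)\<in>{..<d1} \<times> {..<d2}. w p (x, y) * (a x * b y)))\<^sup>2)"

lemma overlap_nonneg: "0 \<le> overlap d1 d2 P w a b"
  by (simp add: overlap_def sum_nonneg)

lemma overlap_le_norm:
  assumes w: "bessel ({..<d1} \<times> {..<d2}) P w" and a: "(\<Sum>x<d1. (cmod (a x))\<^sup>2) \<le> 1"
  shows "overlap d1 d2 P w a b \<le> (\<Sum>y<d2. (cmod (b y))\<^sup>2)"
proof -
  have "overlap d1 d2 P w a b \<le> (\<Sum>(x, y)\<in>{..<d1} \<times> {..<d2}. (cmod (a x * b y))\<^sup>2)"
    using besselD[OF w, of "\<lambda>(x, y). a x * b y"] by (simp add: overlap_def case_prod_beta)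
  also have "\<dots> = (\<Sum>x<d1. (cmod (a x))\<^sup>2) * (\<Sum>y<d2. (cmod (b y))\<^sup>2)"
    by (simp add: sum.cartesian_product[symmetric] norm_mult power_mult_distrib sum_product)
  also have "\<dots> \<le> 1 * (\<Sum>y<d2. (cmod (b y))\<^sup>2)"
    using a by (intro mult_right_mono sum_nonneg) auto
  finally show ?thesis by simp
qed

text \<open>Contracting the first factor with \<open>a\<close> exhibits the overlap as a quadratic
  form in \<open>b\<close>, the shape required by
  \<open>quadratic_form_diagonalization\<close>.\<close>

lemma overlap_contract:
  "overlap d1 d2 P w a b = (\<Sum>p\<in>P. (cmod (\<Sum>y<d2. (\<Sum>x<d1. a x * w p (x, y)) * b y))\<^sup>2)"
proof -
  have "(\<Sum>(x, y)\<in>{..<d1} \<times> {..<d2}. w p (x, y) * (a x * b y))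
      = (\<Sum>y<d2. (\<Sum>x<d1. a x * w p (x, y)) * b y)" for p
    unfolding sum.cartesian_product[symmetric] sum_distrib_right
    by (subst sum.swap) (simp add: mult_ac)
  then show ?thesis by (simp add: overlap_def)
qed

text \<open>The right side is the quadratic form of the partial trace. For each \<open>p\<close>,
  the Bessel inequality of \<open>a\<close> is applied to the contraction of \<open>w p\<close> with
  \<open>b\<close>.\<close>

lemma overlap_sum_le:
  assumes a: "bessel {..<d1} {..<r} a" and P: "finite P"
  shows "(\<Sum>i<r. overlap d1 d2 P w (a i) b)
    \<le> (\<Sum>(p, x)\<in>P \<times> {..<d1}. (cmod (\<Sum>y<d2. w p (x, y) * b y))\<^sup>2)"
proof -
  have eq: "(\<Sum>y<d2. (\<Sum>x<d1. a i x * w p (x, y)) * b y) = (\<Sum>x<d1. a i x * (\<Sum>y<d2. w p (x, y) * b y))"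
    for i p
    unfolding sum_distrib_left sum_distrib_right by (subst sum.swap) (simp add: mult.assoc)
  have "(\<Sum>i<r. overlap d1 d2 P w (a i) b)
      = (\<Sum>p\<in>P. \<Sum>i<r. (cmod (\<Sum>x<d1. a i x * (\<Sum>y<d2. w p (x, y) * b y)))\<^sup>2)"
    unfolding overlap_contract eq by (rule sum.swap)
  also have "\<dots> \<le> (\<Sum>p\<in>P. \<Sum>x<d1. (cmod (\<Sum>y<d2. w p (x, y) * b y))\<^sup>2)"
    by (intro sum_mono besselD[OF a])
  finally show ?thesis by (simp add: sum.cartesian_product)
qed

text \<open>\<open>\<rho>\<close> is the spectrum of the partial trace of \<open>\<Sum>\<^sub>p w\<^sub>p w\<^sub>p\<^sup>*\<close> over the first factor. Compressing the
  first factor to the span of \<open>a\<^sub>0, \<dots>, a\<^sub>r\<^sub>-\<^sub>1\<close> gives an operator bounded both by that partial trace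
  and by \<open>r\<close>, so its eigenvalues are at most \<open>min \<rho>\<^sub>j r\<close>.\<close>

lemma exists_overlap_spectrum:
  fixes w :: "'p \<Rightarrow> nat \<times> nat \<Rightarrow> complex"
  assumes w: "bessel ({..<d1} \<times> {..<d2}) P w" and P: "finite P"
  obtains \<rho> :: "nat \<Rightarrow> real" where
    "\<And>j. j < d2 \<Longrightarrow> 0 \<le> \<rho> j" "(\<Sum>j<d2. \<rho> j) \<le> real (card P)"
    "\<And>r s a b. bessel {..<d1} {..<r} a \<Longrightarrow> bessel {..<d2} {..<s} b \<Longrightarrow> s \<le> d2 \<Longrightarrow>
      (\<Sum>j<s. \<Sum>i<r. overlap d1 d2 P w (a i) (b j)) \<le> (\<Sum>j<s. min (\<rho> j) (real r))"
proof -
  define q where "q b = (\<Sum>(p, x)\<in>P \<times> {..<d1}. (cmod (\<Sum>y<d2. w p (x, y) * b y))\<^sup>2)" for b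
  have fin: "finite (P \<times> {..<d1})" using P by simp
  obtain e \<rho> where e: "orthonormal d2 d2 e"
    and \<rho>: "\<And>i j. i \<le> j \<Longrightarrow> j < d2 \<Longrightarrow> \<rho> j \<le> \<rho> i"
    and qe': "\<And>b. (\<Sum>t\<in>P \<times> {..<d1}. (cmod (\<Sum>y<d2. w (fst t) (snd t, y) * b y))\<^sup>2) =
      (\<Sum>j<d2. \<rho> j * (cmod (\<Sum>y<d2. e j y * b y))\<^sup>2)"
    by (rule quadratic_form_diagonalization[OF fin, where d = d2 and M = "\<lambda>t y. w (fst t) (snd t, y)"], rule that)
  have qe: "q b = (\<Sum>j<d2. \<rho> j * (cmod (\<Sum>y<d2. e j y * b y))\<^sup>2)" for b
    using qe'[of b] by (simp add: q_def case_prod_beta)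
  \<comment> \<open>Evaluating the form at a conjugated eigenvector isolates one eigenvalue;
    nonnegativity and the trace bound are read off from this.\<close>
  have \<rho>q: "\<rho> j = q (\<lambda>y. cnj (e j y))" if "j < d2" for j
    unfolding qe using orthonormal_form_at_cnj[OF e that] by simp
  show ?thesis
  proof
    fix j assume "j < d2"
    then show "0 \<le> \<rho> j" unfolding \<rho>q[OF \<open>j < d2\<close>] q_def by (auto intro!: sum_nonneg)
  next
    \<comment> \<open>By Parseval in the second factor the trace is the sum of the squared norms of
      the \<open>w p\<close>, each at most 1.\<close>
    have "(\<Sum>j<d2. \<rho> j) = (\<Sum>j<d2. q (\<lambda>y. cnj (e j y)))" using \<rho>q by simp
    also have "\<dots> = (\<Sum>(p, x)\<in>P \<times> {..<d1}. \<Sum>j<d2. (cmod (\<Sum>y<d2. w p (x, y) * cnj (e j y)))\<^sup>2)"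
      unfolding q_def case_prod_beta by (rule sum.swap)
    also have "\<dots> = (\<Sum>(p, x)\<in>P \<times> {..<d1}. \<Sum>y<d2. (cmod (w p (x, y)))\<^sup>2)"
    proof -
      have "cmod (\<Sum>y<d2. w p (x, y) * cnj (e j y)) = cmod (\<Sum>y<d2. e j y * cnj (w p (x, y)))" for p x j
        by (subst complex_mod_cnj[symmetric]) (simp add: mult.commute)
      then show ?thesis by (simp add: parseval[OF e])
    qed
    also have "\<dots> = (\<Sum>p\<in>P. \<Sum>t\<in>{..<d1} \<times> {..<d2}. (cmod (w p t))\<^sup>2)"
      by (simp add: sum.cartesian_product[symmetric])
        (simp add: sum.cartesian_product)
    also have "\<dots> \<le> (\<Sum>p\<in>P. 1)"
      using bessel_norm_le[OF w P] by (intro sum_mono) auto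
    finally show "(\<Sum>j<d2. \<rho> j) \<le> real (card P)" by simp
  next
    fix r s :: nat and a b :: "nat \<Rightarrow> nat \<Rightarrow> complex"
    assume a: "bessel {..<d1} {..<r} a" and b: "bessel {..<d2} {..<s} b" and s: "s \<le> d2"
    \<comment> \<open>Indexed by pairs \<open>(i, p)\<close>: the vector left in the second factor
      when \<open>w p\<close> is contracted with \<open>a i\<close>. The resulting form belongs to
      the compressed operator, with spectrum \<open>\<xi>\<close>.\<close>
    define M where "M = (\<lambda>(i, p) y. \<Sum>x<d1. a i x * w p (x, y))"
    have ov: "(\<Sum>i<r. overlap d1 d2 P w (a i) b) = (\<Sum>t\<in>{..<r} \<times> P. (cmod (\<Sum>y<d2. M t y * b y))\<^sup>2)" for b
      unfolding overlap_contract M_def sum.cartesian_product by (simp add: case_prod_beta)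
    have fin: "finite ({..<r} \<times> P)" using P by simp
    obtain c \<xi> where c: "orthonormal d2 d2 c"
      and \<xi>: "\<And>i j. i \<le> j \<Longrightarrow> j < d2 \<Longrightarrow> \<xi> j \<le> \<xi> i"
      and ovc': "\<And>b. (\<Sum>t\<in>{..<r} \<times> P. (cmod (\<Sum>y<d2. M t y * b y))\<^sup>2) =
        (\<Sum>j<d2. \<xi> j * (cmod (\<Sum>y<d2. c j y * b y))\<^sup>2)"
      by (rule quadratic_form_diagonalization[OF fin, where d = d2 and M = M], rule that)
    note ovc = ov[unfolded ovc']
    have \<xi>ov: "\<xi> j = (\<Sum>i<r. overlap d1 d2 P w (a i) (\<lambda>y. cnj (c j y)))" if "j < d2" for j
      unfolding ovc using orthonormal_form_at_cnj[OF c that] by simp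
    have \<xi>0: "0 \<le> \<xi> j" if "j < d2" for j
      unfolding \<xi>ov[OF that] by (intro sum_nonneg overlap_nonneg)
    have \<xi>\<rho>: "\<xi> j \<le> \<rho> j" if "j < d2" for j
    proof (rule weyl_monotonicity[OF c e \<xi> \<rho> _ that])
      fix b
      show "(\<Sum>j<d2. \<xi> j * (cmod (\<Sum>y<d2. c j y * b y))\<^sup>2)
          \<le> (\<Sum>j<d2. \<rho> j * (cmod (\<Sum>y<d2. e j y * b y))\<^sup>2)"
        unfolding qe[symmetric] ovc[symmetric] q_def by (rule overlap_sum_le[OF a P])
    qed
    \<comment> \<open>Each of the \<open>r\<close> overlaps is at most 1, since \<open>w\<close> is
      a Bessel family, \<open>a i\<close> has norm at most 1 and the eigenvector is a unit
      vector.\<close>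
    have \<xi>r: "\<xi> j \<le> real r" if "j < d2" for j
    proof -
      have "\<xi> j \<le> (\<Sum>i<r. \<Sum>y<d2. (cmod (cnj (c j y)))\<^sup>2)"
        unfolding \<xi>ov[OF that]
        by (intro sum_mono overlap_le_norm[OF w] bessel_norm_le[OF a]) auto
      then show ?thesis using orthonormal_norm[OF c that] by simp
    qed
    have "(\<Sum>j<s. \<Sum>i<r. overlap d1 d2 P w (a i) (b j)) \<le> (\<Sum>j<s. \<xi> j)"
      unfolding ovc by (rule bessel_form_le_top[OF c \<xi> \<xi>0 b s])
    also have "\<dots> \<le> (\<Sum>j<s. min (\<rho> j) (real r))"
      using \<xi>\<rho> \<xi>r s by (intro sum_mono) auto
    finally show "(\<Sum>j<s. \<Sum>i<r. overlap d1 d2 P w (a i) (b j)) \<le> (\<Sum>j<s. min (\<rho> j) (real r))" .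
  qed
qed

lemma exists_overlap_weight:
  fixes w :: "'p \<Rightarrow> nat \<times> nat \<Rightarrow> complex"
  assumes w: "bessel ({..<d1} \<times> {..<d2}) P w" and P: "finite P"
  obtains \<omega> :: "nat \<Rightarrow> nat \<Rightarrow> real" where
    "\<And>i j. 0 \<le> \<omega> i j" "\<And>i j. \<omega> i j \<le> 1"
    "(\<Sum>i<d1. \<Sum>j<d2. \<omega> i j) \<le> real (card P)"
    "\<And>r s a b. bessel {..<d1} {..<r} a \<Longrightarrow> bessel {..<d2} {..<s} b \<Longrightarrow> s \<le> d2 \<Longrightarrow>
      (\<Sum>i<r. \<Sum>j<s. overlap d1 d2 P w (a i) (b j)) \<le> (\<Sum>i<r. \<Sum>j<s. \<omega> i j)"
proof -
  obtain \<rho> :: "nat \<Rightarrow> real" where \<rho>: "\<And>j. j < d2 \<Longrightarrow> 0 \<le> \<rho> j" "(\<Sum>j<d2. \<rho> j) \<le> real (card P)"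
    and top: "\<And>r s a b. bessel {..<d1} {..<r} a \<Longrightarrow> bessel {..<d2} {..<s} b \<Longrightarrow> s \<le> d2 \<Longrightarrow>
      (\<Sum>j<s. \<Sum>i<r. overlap d1 d2 P w (a i) (b j)) \<le> (\<Sum>j<s. min (\<rho> j) (real r))"
    by (rule exists_overlap_spectrum[OF w P], rule that)
  \<comment> \<open>Column \<open>j\<close> is filled with mass \<open>\<rho> j\<close> from
    \<open>i = 0\<close> upwards, at most 1 per cell. The sum over \<open>i < r\<close> telescopes
    to \<open>min (\<rho> j) (real r)\<close>; the term at 0 vanishes because
    \<open>\<rho> j\<close> is nonnegative.\<close>
  define \<omega> where "\<omega> i j = min (\<rho> j) (real (Suc i)) - min (\<rho> j) (real i)" for i j
  have col: "(\<Sum>i<r. \<omega> i j) = min (\<rho> j) (real r)" if "j < d2" for r j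
    using \<rho>(1)[OF that] unfolding \<omega>_def
    by (subst sum_lessThan_telescope) simp
  show ?thesis
  proof
    show "0 \<le> \<omega> i j" for i j by (simp add: \<omega>_def)
    show "\<omega> i j \<le> 1" for i j by (auto simp: \<omega>_def min_def)
    have "(\<Sum>i<d1. \<Sum>j<d2. \<omega> i j) = (\<Sum>j<d2. min (\<rho> j) (real d1))"
      using col by (subst sum.swap) simp
    also have "\<dots> \<le> (\<Sum>j<d2. \<rho> j)" by (intro sum_mono) simp
    finally show "(\<Sum>i<d1. \<Sum>j<d2. \<omega> i j) \<le> real (card P)" using \<rho>(2) by simp
  next
    fix r s :: nat and a b :: "nat \<Rightarrow> nat \<Rightarrow> complex"
    assume *: "bessel {..<d1} {..<r} a" "bessel {..<d2} {..<s} b" "s \<le> d2"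
    have "(\<Sum>i<r. \<Sum>j<s. overlap d1 d2 P w (a i) (b j)) \<le> (\<Sum>j<s. min (\<rho> j) (real r))"
      by (subst sum.swap) (rule top[OF *])
    also have "\<dots> = (\<Sum>j<s. \<Sum>i<r. \<omega> i j)" using col *(3) by simp
    also have "\<dots> = (\<Sum>i<r. \<Sum>j<s. \<omega> i j)" by (rule sum.swap)
    finally show "(\<Sum>i<r. \<Sum>j<s. overlap d1 d2 P w (a i) (b j)) \<le> (\<Sum>i<r. \<Sum>j<s. \<omega> i j)" .
  qed
qed

section \<open>Decreasing rearrangements\<close>

lemma decreasing_rearrangement_permutes:
  obtains p where "p permutes {..<dim_vec x}"
    "\<And>i. i < dim_vec x \<Longrightarrow> decreasing_rearrangement x $ i = x $ p i"
proof -
  have "mset (rev (sort (list_of_vec x))) = mset (list_of_vec x)" by simp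
  then obtain p where p: "p permutes {..<length (list_of_vec x)}"
    "permute_list p (list_of_vec x) = rev (sort (list_of_vec x))"
    by (rule mset_eq_permutation)
  have perm: "p permutes {..<dim_vec x}" using p(1) by simp
  show ?thesis
  proof (rule that[OF perm])
    fix i assume i: "i < dim_vec x"
    then have "p i < dim_vec x" using permutes_in_image[OF perm, of i] by auto
    then show "decreasing_rearrangement x $ i = x $ p i"
      unfolding decreasing_rearrangement_def p(2)[symmetric] using p(1) i
      by (simp add: vec_of_list_index permute_list_nth list_of_vec_index)
  qed
qed

lemma decreasing_rearrangement_antimono:
  assumes "i \<le> j" "j < dim_vec x"
  shows "decreasing_rearrangement x $ j \<le> decreasing_rearrangement x $ i"
proof -
  have "rev (sort (list_of_vec x)) ! j \<le> rev (sort (list_of_vec x)) ! i"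
    using assms by (intro sorted_rev_nth_mono) auto
  then show ?thesis by (simp add: decreasing_rearrangement_def vec_of_list_index)
qed

lemma decreasing_rearrangement_id:
  assumes "\<And>i j. i \<le> j \<Longrightarrow> j < dim_vec x \<Longrightarrow> x $ j \<le> x $ i"
  shows "decreasing_rearrangement x = x"
proof -
  have "sorted (rev (list_of_vec x))"
    using assms by (auto simp: sorted_rev_iff_nth_mono list_of_vec_index)
  then have "sort (list_of_vec x) = rev (list_of_vec x)"
    by (intro properties_for_sort) auto
  then show ?thesis by (simp add: decreasing_rearrangement_def vec_list)
qed

lemma sum_decreasing_rearrangement:
  "(\<Sum>i<dim_vec x. decreasing_rearrangement x $ i) = (\<Sum>i<dim_vec x. x $ i)"
proof -
  obtain p where p: "p permutes {..<dim_vec x}"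
    "\<And>i. i < dim_vec x \<Longrightarrow> decreasing_rearrangement x $ i = x $ p i"
    by (rule decreasing_rearrangement_permutes, rule that)
  show ?thesis
    by (subst (2) sum.permute[OF p(1)]) (auto simp: p(2))
qed

text \<open>Moving the weights along the sorting permutation changes neither their bounds nor their
  total, which reduces the claim to \<open>weighted_sum_le_top\<close>.\<close>

lemma weighted_sum_le_decreasing_rearrangement:
  fixes w :: "nat \<Rightarrow> real"
  assumes "\<And>i. i < dim_vec x \<Longrightarrow> 0 \<le> x $ i"
    and "\<And>i. i < dim_vec x \<Longrightarrow> 0 \<le> w i" "\<And>i. i < dim_vec x \<Longrightarrow> w i \<le> 1"
    and "(\<Sum>i<dim_vec x. w i) \<le> real k" and "k \<le> dim_vec x"
  shows "(\<Sum>i<dim_vec x. x $ i * w i) \<le> (\<Sum>i<k. decreasing_rearrangement x $ i)"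
proof -
  obtain p where p: "p permutes {..<dim_vec x}"
    "\<And>i. i < dim_vec x \<Longrightarrow> decreasing_rearrangement x $ i = x $ p i"
    by (rule decreasing_rearrangement_permutes, rule that)
  have pi: "p i < dim_vec x" if "i < dim_vec x" for i
    using permutes_in_image[OF p(1), of i] that by auto
  have "(\<Sum>i<dim_vec x. x $ i * w i)
      = (\<Sum>i<dim_vec x. decreasing_rearrangement x $ i * w (p i))"
    by (subst sum.permute[OF p(1)]) (simp add: p(2))
  also have "\<dots> \<le> (\<Sum>i<k. decreasing_rearrangement x $ i)"
  proof (rule weighted_sum_le_top)
    show "(\<Sum>i<dim_vec x. w (p i)) \<le> real k"
      using assms(4) by (subst (asm) sum.permute[OF p(1)]) simp
    show "0 \<le> decreasing_rearrangement x $ i" if "i < dim_vec x" for i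
      using assms(1)[OF pi[OF that]] p(2)[OF that] by simp
  qed (use assms(2,3,5) pi decreasing_rearrangement_antimono in auto)
  finally show ?thesis .
qed

section \<open>Spectral and singular value decompositions\<close>

text \<open>Common form of the spectral decomposition of a positive semidefinite matrix and of a
  singular value decomposition. Bessel families, unlike orthonormal ones, admit the zero vectors
  that occur on the left for the singular value 0.\<close>

definition bessel_decomposition ::
  "nat \<Rightarrow> complex mat \<Rightarrow> (nat \<Rightarrow> real) \<Rightarrow> (nat \<Rightarrow> nat \<Rightarrow> complex) \<Rightarrow> (nat \<Rightarrow> nat \<Rightarrow> complex) \<Rightarrow> bool"
  where "bessel_decomposition d M \<sigma> a b \<longleftrightarrow>
    bessel {..<d} {..<d} a \<and> bessel {..<d} {..<d} b \<and>
    (\<forall>i j. i \<le> j \<longrightarrow> j < d \<longrightarrow> \<sigma> j \<le> \<sigma> i) \<and> (\<forall>i<d. 0 \<le> \<sigma> i) \<and>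
    (\<forall>x<d. \<forall>y<d. M $$ (x, y) = (\<Sum>i<d. of_real (\<sigma> i) * a i x * cnj (b i y)))"

lemma bessel_decompositionI:
  assumes "bessel {..<d} {..<d} a" "bessel {..<d} {..<d} b"
    and "\<And>i j. i \<le> j \<Longrightarrow> j < d \<Longrightarrow> \<sigma> j \<le> \<sigma> i" "\<And>i. i < d \<Longrightarrow> 0 \<le> \<sigma> i"
    and "\<And>x y. x < d \<Longrightarrow> y < d \<Longrightarrow>
      M $$ (x, y) = (\<Sum>i<d. of_real (\<sigma> i) * a i x * cnj (b i y))"
  shows "bessel_decomposition d M \<sigma> a b"
  using assms unfolding bessel_decomposition_def by blast

lemma spectral_eigenvector:
  fixes l :: "nat \<Rightarrow> complex"
  assumes u: "orthonormal d d u" and "p < d" "x < d"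
    and A: "\<And>x y. x < d \<Longrightarrow> y < d \<Longrightarrow> H x y = (\<Sum>i<d. l i * u i x * cnj (u i y))"
  shows "(\<Sum>y<d. H x y * u p y) = l p * u p x"
proof -
  have "(\<Sum>y<d. H x y * u p y) = (\<Sum>y<d. \<Sum>i<d. l i * u i x * (cnj (u i y) * u p y))"
    using assms(3) by (simp add: A sum_distrib_right mult.assoc)
  also have "\<dots> = (\<Sum>i<d. l i * u i x * (\<Sum>y<d. cnj (u i y) * u p y))"
    by (subst sum.swap) (simp add: sum_distrib_left)
  also have "\<dots> = (\<Sum>i<d. if i = p then l i * u i x else 0)"
    using orthonormalD[OF u] assms(2) by (intro sum.cong) (auto simp: mult.commute[of "cnj _"])
  finally show ?thesis using assms(2) by simp
qed

text \<open>The last conclusion writes a sum of leading eigenvalues as a sum of form values, the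
  left side of \<open>tensor_sum_form_le\<close>.\<close>

lemma hermitian_eigenvalue_attained:
  assumes herm: "hermitian_mat A" and A: "A \<in> carrier_mat d d"
  obtains u where "orthonormal d d u"
    "\<And>x y. x < d \<Longrightarrow> y < d \<Longrightarrow>
       A $$ (x, y) = (\<Sum>i<d. of_real (eigenvalue_vec A $ i) * u i x * cnj (u i y))"
    "\<And>p. p < d \<Longrightarrow>
       (\<Sum>x<d. \<Sum>y<d. cnj (u p x) * A $$ (x, y) * u p y) = of_real (eigenvalue_vec A $ p)"
proof -
  obtain u where u: "orthonormal d d u"
    and rep: "\<And>x y. x < d \<Longrightarrow> y < d \<Longrightarrow>
       A $$ (x, y) = (\<Sum>i<d. of_real (eigenvalue_vec A $ i) * u i x * cnj (u i y))"
    by (rule hermitian_spectral[OF herm A], rule that)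
  show ?thesis
  proof (rule that[OF u rep])
    fix p assume p: "p < d"
    have "(\<Sum>x<d. \<Sum>y<d. cnj (u p x) * A $$ (x, y) * u p y)
        = (\<Sum>x<d. cnj (u p x) * (\<Sum>y<d. A $$ (x, y) * u p y))"
      by (simp add: sum_distrib_left mult.assoc)
    also have "\<dots> = (\<Sum>x<d. of_real (eigenvalue_vec A $ p) * (u p x * cnj (u p x)))"
      using spectral_eigenvector[OF u p _ rep] by (intro sum.cong) auto
    also have "\<dots> = of_real (eigenvalue_vec A $ p)"
      using orthonormalD[OF u p p] by (simp flip: sum_distrib_left)
    finally show "(\<Sum>x<d. \<Sum>y<d. cnj (u p x) * A $$ (x, y) * u p y) = of_real (eigenvalue_vec A $ p)" .
  qed
qed

text \<open>Trace of the spectral sum, each eigenvector having norm 1. It provides the equality that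
  turns weak majorization into majorization.\<close>

lemma sum_eigenvalue_vec:
  assumes herm: "hermitian_mat A" and A: "A \<in> carrier_mat d d"
  shows "complex_of_real (\<Sum>i<d. eigenvalue_vec A $ i) = (\<Sum>x<d. A $$ (x, x))"
proof -
  obtain u where u: "orthonormal d d u"
    and rep: "\<And>x y. x < d \<Longrightarrow> y < d \<Longrightarrow>
       A $$ (x, y) = (\<Sum>i<d. of_real (eigenvalue_vec A $ i) * u i x * cnj (u i y))"
    by (rule hermitian_spectral[OF herm A], rule that)
  have "(\<Sum>x<d. A $$ (x, x)) = (\<Sum>i<d. of_real (eigenvalue_vec A $ i) * (\<Sum>x<d. u i x * cnj (u i x)))"
    unfolding sum_distrib_left by (subst sum.swap) (simp add: rep mult.assoc)
  then show ?thesis using orthonormalD[OF u] by simp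
qed

lemma psd_eigenvalue_nonneg:
  assumes psd: "psd_mat A" and A: "A \<in> carrier_mat d d" and p: "p < d"
  shows "0 \<le> eigenvalue_vec A $ p"
proof -
  have herm: "hermitian_mat A" using psd by (simp add: psd_mat_def)
  obtain u where u: "\<And>p. p < d \<Longrightarrow>
       (\<Sum>x<d. \<Sum>y<d. cnj (u p x) * A $$ (x, y) * u p y) = of_real (eigenvalue_vec A $ p)"
    by (rule hermitian_eigenvalue_attained[OF herm A], rule that)
  have "(A *\<^sub>v vec d (u p)) \<bullet>c vec d (u p) = (\<Sum>x<d. (\<Sum>y<d. A $$ (x, y) * u p y) * cnj (u p x))"
    using A by (simp add: scalar_prod_def lessThan_atLeast0)
  also have "\<dots> = (\<Sum>x<d. \<Sum>y<d. cnj (u p x) * A $$ (x, y) * u p y)"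
    unfolding sum_distrib_right by (simp add: mult_ac)
  finally have "(A *\<^sub>v vec d (u p)) \<bullet>c vec d (u p) = \<dots>" .
  moreover have "0 \<le> Re ((A *\<^sub>v vec d (u p)) \<bullet>c vec d (u p))"
    using psd A by (auto simp: psd_mat_def)
  ultimately show ?thesis using u[OF p] by simp
qed

lemma psd_bessel_decomposition:
  assumes psd: "psd_mat A" and A: "A \<in> carrier_mat d d"
  obtains u where "bessel_decomposition d A (\<lambda>i. eigenvalue_vec A $ i) u u"
proof -
  have herm: "hermitian_mat A" using psd by (simp add: psd_mat_def)
  obtain u where u: "orthonormal d d u"
    and rep: "\<And>x y. x < d \<Longrightarrow> y < d \<Longrightarrow>
       A $$ (x, y) = (\<Sum>i<d. of_real (eigenvalue_vec A $ i) * u i x * cnj (u i y))"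
    by (rule hermitian_spectral[OF herm A], rule that)
  have "bessel_decomposition d A (\<lambda>i. eigenvalue_vec A $ i) u u"
  proof (rule bessel_decompositionI[OF _ _ _ psd_eigenvalue_nonneg[OF psd A] rep])
    show "eigenvalue_vec A $ j \<le> eigenvalue_vec A $ i" if "i \<le> j" "j < d" for i j
      using that eigenvalue_vec_carrier[OF A] by (intro eigenvalue_vec_antimono) auto
  qed (use orthonormal_bessel[OF u] in auto)
  then show ?thesis by (rule that)
qed

text \<open>The left singular vectors belonging to the singular value \<open>0\<close> are set to \<open>0\<close> (the value of a
  division by \<open>0\<close>); the family of left singular vectors remains a Bessel family.\<close>

lemma singular_value_decomposition:
  assumes M: "M \<in> carrier_mat d d"
  obtains a b where "bessel_decomposition d M (\<lambda>i. singular_value_vec M $ i) a b"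
    "\<And>p. p < d \<Longrightarrow>
       (\<Sum>x<d. \<Sum>y<d. cnj (a p x) * M $$ (x, y) * b p y) = of_real (singular_value_vec M $ p)"
proof -
  define H where "H = mat_adjoint M * M"
  have H: "H \<in> carrier_mat d d" using M unfolding H_def by (intro mult_carrier_mat[of _ d d] carrier_matI) auto
  have Hi: "H $$ (x, y) = (\<Sum>z<d. M $$ (z, y) * cnj (M $$ (z, x)))" if "x < d" "y < d" for x y
    using M that by (auto simp: H_def scalar_prod_def index_mat_adjoint lessThan_atLeast0 mult.commute)
  have "mat_adjoint H = H"
    using H by (intro eq_matI) (auto simp: index_mat_adjoint Hi mult.commute)
  then have herm: "hermitian_mat H" using H by (auto simp: hermitian_mat_def)
  obtain v where v: "orthonormal d d v"
    and rep: "\<And>x y. x < d \<Longrightarrow> y < d \<Longrightarrow>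
       H $$ (x, y) = (\<Sum>i<d. of_real (eigenvalue_vec H $ i) * v i x * cnj (v i y))"
    by (rule hermitian_spectral[OF herm H], rule that)
  define l where "l i = eigenvalue_vec H $ i" for i
  define s where "s i = sqrt (l i)" for i
  have sv: "singular_value_vec M $ i = s i" if "i < d" for i
    using eigenvalue_vec_carrier[OF H] that by (simp add: singular_value_vec_def s_def l_def H_def)
  \<comment> \<open>\<open>m i\<close> is \<open>M\<close> applied to the right singular vector
    \<open>v i\<close>; the left singular vector will be its quotient by the singular value
    \<open>s i\<close>.\<close>
  define m where "m i z = (\<Sum>y<d. M $$ (z, y) * v i y)" for i z
  \<comment> \<open>The Gram matrix of the \<open>m i\<close> is the matrix of \<open>H\<close> in
    its eigenbasis, hence diagonal; in particular \<open>l i\<close> is a squared norm.\<close>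
  have mm: "(\<Sum>z<d. m i z * cnj (m j z)) = (if i = j then of_real (l i) else 0)" if ij: "i < d" "j < d" for i j
  proof -
    have "(\<Sum>z<d. m i z * cnj (m j z))
        = (\<Sum>z<d. \<Sum>x<d. \<Sum>y<d. cnj (v j x) * (M $$ (z, y) * cnj (M $$ (z, x)) * v i y))"
      unfolding m_def cnj_sum sum_product by (rule sum.cong[OF refl], subst sum.swap) (simp add: mult_ac)
    also have "\<dots> = (\<Sum>x<d. \<Sum>y<d. \<Sum>z<d. cnj (v j x) * (M $$ (z, y) * cnj (M $$ (z, x)) * v i y))"
      by (subst sum.swap, rule sum.cong[OF refl], rule sum.swap)
    also have "\<dots> = (\<Sum>x<d. cnj (v j x) * (\<Sum>y<d. H $$ (x, y) * v i y))"
      by (simp add: Hi sum_distrib_left sum_distrib_right)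
    also have "\<dots> = (\<Sum>x<d. of_real (l i) * (v i x * cnj (v j x)))"
      using spectral_eigenvector[OF v ij(1) _ rep] by (intro sum.cong) (auto simp: l_def)
    also have "\<dots> = (if i = j then of_real (l i) else 0)"
      using orthonormalD[OF v ij] by (simp flip: sum_distrib_left)
    finally show ?thesis .
  qed
  have lm: "l i = (\<Sum>z<d. (cmod (m i z))\<^sup>2)" if "i < d" for i
  proof -
    have "complex_of_real (l i) = of_real (\<Sum>z<d. (cmod (m i z))\<^sup>2)"
      using mm[OF that that] by (simp add: sum_cnj_self)
    then show ?thesis by (simp only: of_real_eq_iff)
  qed
  have l0: "0 \<le> l i" if "i < d" for i unfolding lm[OF that] by (simp add: sum_nonneg)
  define a where "a i x = m i x / of_real (s i)" for i x
  \<comment> \<open>If \<open>s i = 0\<close>, then \<open>m i\<close> has norm 0, so the default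
    value of the division does no harm.\<close>
  have sa: "of_real (s i) * a i x = m i x" if "i < d" "x < d" for i x
  proof (cases "s i = 0")
    case True
    then have "(\<Sum>z<d. (cmod (m i z))\<^sup>2) = 0" using lm[OF that(1)] by (simp add: s_def)
    then have "m i x = 0" using that by (simp add: sum_nonneg_eq_0_iff)
    then show ?thesis using True by simp
  qed (simp add: a_def)
  have ss: "s i * s i = l i" if "i < d" for i using l0[OF that] by (simp add: s_def)
  have bessel_a: "bessel {..<d} {..<d} a"
  proof (rule bessel_orthogonal)
    fix i j assume "i \<in> {..<d}" "j \<in> {..<d}" "i \<noteq> j"
    then have "(\<Sum>x<d. m i x * cnj (m j x)) = 0" using mm by simp
    then show "(\<Sum>x<d. a i x * cnj (a j x)) = 0"
      by (simp add: a_def flip: sum_divide_distrib)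
  next
    fix i assume i: "i \<in> {..<d}"
    have "(\<Sum>x<d. (cmod (a i x))\<^sup>2) = (\<Sum>x<d. (cmod (m i x))\<^sup>2) / (s i)\<^sup>2"
      by (simp add: a_def norm_divide power_divide sum_divide_distrib)
    \<comment> \<open>This quotient is 1, or 0 when \<open>l i = 0\<close>.\<close>
    also have "\<dots> = l i / l i" using lm ss i by (simp add: power2_eq_square)
    finally show "(\<Sum>x<d. (cmod (a i x))\<^sup>2) \<le> 1" by simp
  qed auto
  have Mrep: "M $$ (x, y) = (\<Sum>i<d. of_real (s i) * a i x * cnj (v i y))" if xy: "x < d" "y < d" for x y
  proof -
    have "(\<Sum>i<d. of_real (s i) * a i x * cnj (v i y)) = (\<Sum>i<d. m i x * cnj (v i y))"
      using sa xy by simp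
    also have "\<dots> = (\<Sum>z<d. M $$ (x, z) * (\<Sum>i<d. v i z * cnj (v i y)))"
      unfolding m_def sum_distrib_left sum_distrib_right by (subst sum.swap) (simp add: mult.assoc)
    also have "\<dots> = (\<Sum>z<d. if z = y then M $$ (x, z) else 0)"
      using orthonormal_complete[OF v] xy by (intro sum.cong) auto
    finally show ?thesis using xy by simp
  qed
  have "bessel_decomposition d M (\<lambda>i. singular_value_vec M $ i) a v"
  proof (rule bessel_decompositionI[OF bessel_a orthonormal_bessel[OF v]])
    show "singular_value_vec M $ j \<le> singular_value_vec M $ i" if "i \<le> j" "j < d" for i j
      using that eigenvalue_vec_antimono[of i j H] eigenvalue_vec_carrier[OF H]
      by (simp add: sv s_def l_def)
    show "0 \<le> singular_value_vec M $ i" if "i < d" for i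
      using that l0 by (simp add: sv s_def)
    show "M $$ (x, y) = (\<Sum>i<d. of_real (singular_value_vec M $ i) * a i x * cnj (v i y))"
      if "x < d" "y < d" for x y
      using Mrep[OF that] by (simp add: sv)
  qed
  moreover have "(\<Sum>x<d. \<Sum>y<d. cnj (a p x) * M $$ (x, y) * v p y) = of_real (singular_value_vec M $ p)"
    if p: "p < d" for p
  proof -
    have "(\<Sum>x<d. \<Sum>y<d. cnj (a p x) * M $$ (x, y) * v p y) = (\<Sum>x<d. cnj (a p x) * m p x)"
      by (simp add: m_def sum_distrib_left mult.assoc)
    also have "\<dots> = (\<Sum>x<d. m p x * cnj (m p x)) / of_real (s p)"
      by (simp add: a_def sum_divide_distrib mult.commute)
    \<comment> \<open>For \<open>s p = 0\<close> the quotient is 0 by convention, which is again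
      \<open>s p\<close>.\<close>
    also have "\<dots> = of_real (s p * s p / s p)" using mm[OF p p] ss[OF p] by simp
    also have "\<dots> = of_real (s p)" by simp
    finally show ?thesis using sv[OF p] by simp
  qed
  ultimately show ?thesis by (rule that)
qed

section \<open>Sums of tensor products\<close>

lemma sum_pair_index:
  fixes f :: "nat \<Rightarrow> 'a :: comm_monoid_add"
  shows "(\<Sum>p<d1 * d2. f p) = (\<Sum>(i, j)\<in>{..<d1} \<times> {..<d2}. f (i * d2 + j))"
proof -
  have "(\<Sum>p<d1 * d2. f p) = (\<Sum>i<d1. sum f {i * d2..<i * d2 + d2})"
    by (rule sum.nat_group[symmetric])
  also have "\<dots> = (\<Sum>i<d1. \<Sum>j<d2. f (i * d2 + j))"
  proof (rule sum.cong[OF refl])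
    fix i
    show "sum f {i * d2..<i * d2 + d2} = (\<Sum>j<d2. f (i * d2 + j))"
      using sum.atLeastLessThan_shift_0[of f "i * d2" "i * d2 + d2"]
      by (simp add: lessThan_atLeast0 comp_def)
  qed
  finally show ?thesis by (simp add: sum.cartesian_product)
qed

lemma bessel_pair_index:
  fixes d1 d2 :: nat
  assumes "bessel {..<d1 * d2} K u"
  shows "bessel ({..<d1} \<times> {..<d2}) K (\<lambda>k (i, j). u k (i * d2 + j))"
  unfolding bessel_def
proof
  fix z :: "nat \<times> nat \<Rightarrow> complex"
  have eq: "(i * d2 + j) div d2 = i" "(i * d2 + j) mod d2 = j" if "j < d2" for i j :: nat
    using that by auto
  have "(\<Sum>p<d1 * d2. u k p * z (p div d2, p mod d2))
      = (\<Sum>x\<in>{..<d1} \<times> {..<d2}. (\<lambda>(i, j). u k (i * d2 + j)) x * z x)" for k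
    unfolding sum_pair_index by (intro sum.cong) (auto simp: eq)
  moreover have "(\<Sum>p<d1 * d2. (cmod (z (p div d2, p mod d2)))\<^sup>2)
      = (\<Sum>x\<in>{..<d1} \<times> {..<d2}. (cmod (z x))\<^sup>2)"
    unfolding sum_pair_index by (intro sum.cong) (auto simp: eq)
  ultimately show "(\<Sum>k\<in>K. (cmod (\<Sum>x\<in>{..<d1} \<times> {..<d2}. (\<lambda>(i, j). u k (i * d2 + j)) x * z x))\<^sup>2)
      \<le> (\<Sum>x\<in>{..<d1} \<times> {..<d2}. (cmod (z x))\<^sup>2)"
    using besselD[OF assms, of "\<lambda>p. z (p div d2, p mod d2)"] by simp
qed

section \<open>Forms of sums of tensor products on Bessel families\<close>

lemma tensor_form_expand:
  assumes A: "\<And>x y. x < d1 \<Longrightarrow> y < d1 \<Longrightarrow> A x y = (\<Sum>i<d1. of_real (\<alpha> i) * a i x * cnj (a' i y))"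
    and B: "\<And>x y. x < d2 \<Longrightarrow> y < d2 \<Longrightarrow> B x y = (\<Sum>i<d2. of_real (\<beta> i) * b i x * cnj (b' i y))"
  shows "(\<Sum>s\<in>{..<d1} \<times> {..<d2}. \<Sum>t\<in>{..<d1} \<times> {..<d2}.
      f s * (A (fst s) (fst t) * B (snd s) (snd t)) * g t)
    = (\<Sum>i<d1. \<Sum>j<d2. of_real (\<alpha> i * \<beta> j) *
        ((\<Sum>(x, y)\<in>{..<d1} \<times> {..<d2}. f (x, y) * (a i x * b j y)) *
         (\<Sum>(x, y)\<in>{..<d1} \<times> {..<d2}. g (x, y) * (cnj (a' i x) * cnj (b' j y)))))"
    (is "?L = ?R")
proof -
  let ?I = "{..<d1} \<times> {..<d2}"
  \<comment> \<open>Each summand splits into an amplitude of \<open>f\<close> against the left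
    vectors and one of \<open>g\<close> against the conjugated right vectors, so the double sum over
    \<open>s\<close> and \<open>t\<close> factors.\<close>
  define F where "F i j s = f s * (a i (fst s) * b j (snd s))" for i j s
  define G where "G i j t = g t * (cnj (a' i (fst t)) * cnj (b' j (snd t)))" for i j t
  have "?L = (\<Sum>s\<in>?I. \<Sum>t\<in>?I. \<Sum>ij\<in>?I. of_real (\<alpha> (fst ij) * \<beta> (snd ij)) * (F (fst ij) (snd ij) s * G (fst ij) (snd ij) t))"
  proof (intro sum.cong refl)
    fix s t assume "s \<in> ?I" "t \<in> ?I"
    then have *: "A (fst s) (fst t) * B (snd s) (snd t) =
      (\<Sum>(i, j)\<in>?I. (of_real (\<alpha> i) * a i (fst s) * cnj (a' i (fst t))) * (of_real (\<beta> j) * b j (snd s) * cnj (b' j (snd t))))"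
      by (auto simp: A B sum_product sum.cartesian_product)
    show "f s * (A (fst s) (fst t) * B (snd s) (snd t)) * g t = (\<Sum>ij\<in>?I. of_real (\<alpha> (fst ij) * \<beta> (snd ij)) * (F (fst ij) (snd ij) s * G (fst ij) (snd ij) t))"
      unfolding * sum_distrib_left sum_distrib_right
      by (intro sum.cong refl) (auto simp: F_def G_def mult_ac)
  qed
  also have "\<dots> = (\<Sum>s\<in>?I. \<Sum>ij\<in>?I. \<Sum>t\<in>?I. of_real (\<alpha> (fst ij) * \<beta> (snd ij)) * (F (fst ij) (snd ij) s * G (fst ij) (snd ij) t))"
    by (rule sum.cong[OF refl], rule sum.swap)
  also have "\<dots> = (\<Sum>ij\<in>?I. \<Sum>s\<in>?I. \<Sum>t\<in>?I. of_real (\<alpha> (fst ij) * \<beta> (snd ij)) * (F (fst ij) (snd ij) s * G (fst ij) (snd ij) t))"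
    by (rule sum.swap)
  also have "\<dots> = (\<Sum>ij\<in>?I. of_real (\<alpha> (fst ij) * \<beta> (snd ij)) * ((\<Sum>s\<in>?I. F (fst ij) (snd ij) s) * (\<Sum>t\<in>?I. G (fst ij) (snd ij) t)))"
    by (rule sum.cong[OF refl], subst sum_product) (simp only: sum_distrib_left)
  also have "\<dots> = ?R"
    by (simp add: sum.cartesian_product F_def G_def case_prod_beta)
  finally show ?thesis .
qed

text \<open>The inequality of arithmetic and geometric means decouples the left family from the
  right one, so that weights for \<open>u\<close> and \<open>v\<close> can be chosen
  separately.\<close>

lemma sum_overlap_bound:
  assumes P: "finite P"
  shows "Re (\<Sum>p\<in>P. (\<Sum>(x, y)\<in>{..<d1} \<times> {..<d2}. u p (x, y) * (a x * b y)) *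
        (\<Sum>(x, y)\<in>{..<d1} \<times> {..<d2}. v p (x, y) * (a' x * b' y)))
    \<le> (overlap d1 d2 P u a b + overlap d1 d2 P v a' b') / 2"
proof -
  have am: "Re (s * t) \<le> ((cmod s)\<^sup>2 + (cmod t)\<^sup>2) / 2" for s t
  proof -
    have "Re (s * t) \<le> cmod s * cmod t" by (metis complex_Re_le_cmod norm_mult)
    also have "\<dots> \<le> ((cmod s)\<^sup>2 + (cmod t)\<^sup>2) / 2"
      using sum_squares_bound[of "cmod s" "cmod t"] by simp
    finally show ?thesis .
  qed
  have "Re (\<Sum>p\<in>P. (\<Sum>(x, y)\<in>{..<d1} \<times> {..<d2}. u p (x, y) * (a x * b y)) *
        (\<Sum>(x, y)\<in>{..<d1} \<times> {..<d2}. v p (x, y) * (a' x * b' y)))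
    \<le> (\<Sum>p\<in>P. ((cmod (\<Sum>(x, y)\<in>{..<d1} \<times> {..<d2}. u p (x, y) * (a x * b y)))\<^sup>2 +
        (cmod (\<Sum>(x, y)\<in>{..<d1} \<times> {..<d2}. v p (x, y) * (a' x * b' y)))\<^sup>2) / 2)"
    unfolding Re_sum by (rule sum_mono) (rule am)
  also have "\<dots> = (overlap d1 d2 P u a b + overlap d1 d2 P v a' b') / 2"
    unfolding overlap_def by (simp add: sum.distrib add_divide_distrib sum_divide_distrib)
  finally show ?thesis .
qed

text \<open>The upper bound of Ky Fan's principle, for arbitrary Bessel families \<open>U\<close>
  and \<open>V\<close>; singular vectors or eigenvectors of the sum are substituted later.\<close>

lemma tensor_sum_form_le:
  fixes A B :: "'l \<Rightarrow> complex mat" and y :: "real vec"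
  assumes L: "finite L"
    and A: "\<And>l. l \<in> L \<Longrightarrow> bessel_decomposition d1 (A l) (\<alpha> l) (a l) (a' l)"
    and B: "\<And>l. l \<in> L \<Longrightarrow> bessel_decomposition d2 (B l) (\<beta> l) (b l) (b' l)"
    and X: "\<And>i i' j j'. i < d1 \<Longrightarrow> j < d2 \<Longrightarrow> i' < d1 \<Longrightarrow> j' < d2 \<Longrightarrow>
      X (i * d2 + j) (i' * d2 + j') = (\<Sum>l\<in>L. A l $$ (i, i') * B l $$ (j, j'))"
    and y: "y \<in> carrier_vec (d1 * d2)"
      "\<And>i j. i < d1 \<Longrightarrow> j < d2 \<Longrightarrow> y $ (i * d2 + j) = (\<Sum>l\<in>L. \<alpha> l i * \<beta> l j)"
    and U: "bessel {..<d1 * d2} {..<k} U" and V: "bessel {..<d1 * d2} {..<k} V"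
    and k: "k \<le> d1 * d2"
  shows "Re (\<Sum>p<k. \<Sum>s<d1 * d2. \<Sum>t<d1 * d2. cnj (U p s) * X s t * V p t)
    \<le> (\<Sum>i<k. decreasing_rearrangement y $ i)"
proof -
  let ?I = "{..<d1} \<times> {..<d2}"
  \<comment> \<open>The form conjugates \<open>U\<close> while \<open>overlap\<close> pairs
    bilinearly, so the conjugate is absorbed into \<open>u\<close>.\<close>
  define u where "u p = (\<lambda>(i, j). cnj (U p (i * d2 + j)))" for p
  define v where "v p = (\<lambda>(i, j). V p (i * d2 + j))" for p
  have u: "bessel ?I {..<k} u" and v: "bessel ?I {..<k} v"
    unfolding u_def v_def by (rule bessel_pair_index[OF bessel_cnj[OF U]] bessel_pair_index[OF V])+
  have fin: "finite {..<k}" by simp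
  \<comment> \<open>Both weights are fixed before any \<open>l\<close> is considered; they depend on
    \<open>U\<close> and \<open>V\<close> only.\<close>
  obtain \<omega> :: "nat \<Rightarrow> nat \<Rightarrow> real" where \<omega>: "\<And>i j. 0 \<le> \<omega> i j" "\<And>i j. \<omega> i j \<le> 1"
      "(\<Sum>i<d1. \<Sum>j<d2. \<omega> i j) \<le> real (card {..<k})"
    and \<omega>_le: "\<And>r s a b. bessel {..<d1} {..<r} a \<Longrightarrow> bessel {..<d2} {..<s} b \<Longrightarrow> s \<le> d2 \<Longrightarrow>
      (\<Sum>i<r. \<Sum>j<s. overlap d1 d2 {..<k} u (a i) (b j)) \<le> (\<Sum>i<r. \<Sum>j<s. \<omega> i j)"
    by (rule exists_overlap_weight[OF u fin], rule that)
  obtain \<omega>' :: "nat \<Rightarrow> nat \<Rightarrow> real" where \<omega>': "\<And>i j. 0 \<le> \<omega>' i j" "\<And>i j. \<omega>' i j \<le> 1"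
      "(\<Sum>i<d1. \<Sum>j<d2. \<omega>' i j) \<le> real (card {..<k})"
    and \<omega>'_le: "\<And>r s a b. bessel {..<d1} {..<r} a \<Longrightarrow> bessel {..<d2} {..<s} b \<Longrightarrow> s \<le> d2 \<Longrightarrow>
      (\<Sum>i<r. \<Sum>j<s. overlap d1 d2 {..<k} v (a i) (b j)) \<le> (\<Sum>i<r. \<Sum>j<s. \<omega>' i j)"
    by (rule exists_overlap_weight[OF v fin], rule that)
  \<comment> \<open>The average of the two weights at the encoded index keeps the bounds 0 and 1 and
    the total of at most \<open>k\<close>.\<close>
  define w where "w p = (\<omega> (p div d2) (p mod d2) + \<omega>' (p div d2) (p mod d2)) / 2" for p
  have w: "w (i * d2 + j) = (\<omega> i j + \<omega>' i j) / 2" if "j < d2" for i j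
    using that by (simp add: w_def)
  define F where "F l i j p = (\<Sum>(x, y)\<in>?I. u p (x, y) * (a l i x * b l j y))" for l i j p
  define G where "G l i j p = (\<Sum>(x, y)\<in>?I. v p (x, y) * (cnj (a' l i x) * cnj (b' l j y)))" for l i j p
  have form: "(\<Sum>s<d1 * d2. \<Sum>t<d1 * d2. cnj (U p s) * X s t * V p t)
      = (\<Sum>l\<in>L. \<Sum>i<d1. \<Sum>j<d2. of_real (\<alpha> l i * \<beta> l j) * (F l i j p * G l i j p))" for p
  proof -
    have "(\<Sum>s<d1 * d2. \<Sum>t<d1 * d2. cnj (U p s) * X s t * V p t)
        = (\<Sum>s\<in>?I. \<Sum>t\<in>?I. \<Sum>l\<in>L. u p s * (A l $$ (fst s, fst t) * B l $$ (snd s, snd t)) * v p t)"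
      unfolding sum_pair_index
      by (intro sum.cong refl)
        (auto simp: X u_def v_def sum_distrib_left sum_distrib_right intro!: sum.cong)
    also have "\<dots> = (\<Sum>l\<in>L. \<Sum>s\<in>?I. \<Sum>t\<in>?I. u p s * (A l $$ (fst s, fst t) * B l $$ (snd s, snd t)) * v p t)"
      by (rule trans[OF sum.cong[OF refl sum.swap] sum.swap])
    also have "\<dots> = (\<Sum>l\<in>L. \<Sum>i<d1. \<Sum>j<d2. of_real (\<alpha> l i * \<beta> l j) * (F l i j p * G l i j p))"
      unfolding F_def G_def
    proof (rule sum.cong[OF refl], rule tensor_form_expand[where A = "\<lambda>x y. A _ $$ (x, y)" and B = "\<lambda>x y. B _ $$ (x, y)"])
    qed (use A B in \<open>auto simp: bessel_decomposition_def\<close>)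
    finally show ?thesis .
  qed
  have "(\<Sum>p<k. \<Sum>s<d1 * d2. \<Sum>t<d1 * d2. cnj (U p s) * X s t * V p t)
      = (\<Sum>l\<in>L. \<Sum>i<d1. \<Sum>j<d2. of_real (\<alpha> l i * \<beta> l j) * (\<Sum>p<k. F l i j p * G l i j p))"
    unfolding form sum_distrib_left
    by (subst sum.swap, rule sum.cong[OF refl], subst sum.swap, rule sum.cong[OF refl], rule sum.swap)
  moreover have "Re (of_real r * z) = r * Re z" for r z by simp
  ultimately have "Re (\<Sum>p<k. \<Sum>s<d1 * d2. \<Sum>t<d1 * d2. cnj (U p s) * X s t * V p t)
      = (\<Sum>l\<in>L. \<Sum>i<d1. \<Sum>j<d2. \<alpha> l i * \<beta> l j * Re (\<Sum>p<k. F l i j p * G l i j p))"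
    by (simp only: Re_sum)
  also have "\<dots> \<le> (\<Sum>l\<in>L. \<Sum>i<d1. \<Sum>j<d2. \<alpha> l i * \<beta> l j * ((\<omega> i j + \<omega>' i j) / 2))"
  proof (rule sum_mono)
    fix l assume l: "l \<in> L"
    have a: "bessel {..<d1} {..<d1} (a l)" "bessel {..<d1} {..<d1} (\<lambda>i x. cnj (a' l i x))"
      and \<alpha>: "\<And>i j. i \<le> j \<Longrightarrow> j < d1 \<Longrightarrow> \<alpha> l j \<le> \<alpha> l i" "\<And>i. i < d1 \<Longrightarrow> 0 \<le> \<alpha> l i"
      and b: "bessel {..<d2} {..<d2} (b l)" "bessel {..<d2} {..<d2} (\<lambda>i x. cnj (b' l i x))"
      and \<beta>: "\<And>i j. i \<le> j \<Longrightarrow> j < d2 \<Longrightarrow> \<beta> l j \<le> \<beta> l i" "\<And>i. i < d2 \<Longrightarrow> 0 \<le> \<beta> l i"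
      using A[OF l] B[OF l] by (auto simp: bessel_decomposition_def intro: bessel_cnj)
    have "(\<Sum>i<d1. \<Sum>j<d2. \<alpha> l i * \<beta> l j * Re (\<Sum>p<k. F l i j p * G l i j p))
        \<le> (\<Sum>i<d1. \<Sum>j<d2. \<alpha> l i * \<beta> l j *
            ((overlap d1 d2 {..<k} u (a l i) (b l j) +
              overlap d1 d2 {..<k} v (\<lambda>x. cnj (a' l i x)) (\<lambda>x. cnj (b' l j x))) / 2))"
      unfolding F_def G_def using \<alpha>(2) \<beta>(2)
      by (intro sum_mono mult_left_mono sum_overlap_bound mult_nonneg_nonneg) auto
    also have "\<dots> = ((\<Sum>i<d1. \<Sum>j<d2. \<alpha> l i * \<beta> l j * overlap d1 d2 {..<k} u (a l i) (b l j)) +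
        (\<Sum>i<d1. \<Sum>j<d2. \<alpha> l i * \<beta> l j *
          overlap d1 d2 {..<k} v (\<lambda>x. cnj (a' l i x)) (\<lambda>x. cnj (b' l j x)))) / 2"
      by (simp add: sum.distrib add_divide_distrib sum_divide_distrib distrib_left)
    also have "\<dots> \<le> ((\<Sum>i<d1. \<Sum>j<d2. \<alpha> l i * \<beta> l j * \<omega> i j) +
        (\<Sum>i<d1. \<Sum>j<d2. \<alpha> l i * \<beta> l j * \<omega>' i j)) / 2"
    proof (intro divide_right_mono add_mono abel_rectangle_le \<alpha> \<beta>)
      fix r s assume r: "r \<le> d1" and s: "s \<le> d2"
      \<comment> \<open>A corner sum involves only the first \<open>r\<close> and \<open>s\<close>
        members of the families, and truncation keeps them Bessel.\<close>
      have sub: "bessel {..<d1} {..<r} c" if "bessel {..<d1} {..<d1} c" for c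
        using bessel_subset[OF that, of "{..<r}"] r by auto
      have sub': "bessel {..<d2} {..<s} c" if "bessel {..<d2} {..<d2} c" for c
        using bessel_subset[OF that, of "{..<s}"] s by auto
      show "(\<Sum>i<r. \<Sum>j<s. overlap d1 d2 {..<k} u (a l i) (b l j)) \<le> (\<Sum>i<r. \<Sum>j<s. \<omega> i j)"
        by (rule \<omega>_le[OF sub[OF a(1)] sub'[OF b(1)] s])
      show "(\<Sum>i<r. \<Sum>j<s. overlap d1 d2 {..<k} v (\<lambda>x. cnj (a' l i x)) (\<lambda>x. cnj (b' l j x)))
          \<le> (\<Sum>i<r. \<Sum>j<s. \<omega>' i j)"
        by (rule \<omega>'_le[OF sub[OF a(2)] sub'[OF b(2)] s])
    qed auto
    also have "\<dots> = (\<Sum>i<d1. \<Sum>j<d2. \<alpha> l i * \<beta> l j * ((\<omega> i j + \<omega>' i j) / 2))"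
      by (simp add: sum.distrib add_divide_distrib sum_divide_distrib distrib_left)
    finally show "(\<Sum>i<d1. \<Sum>j<d2. \<alpha> l i * \<beta> l j * Re (\<Sum>p<k. F l i j p * G l i j p))
        \<le> (\<Sum>i<d1. \<Sum>j<d2. \<alpha> l i * \<beta> l j * ((\<omega> i j + \<omega>' i j) / 2))" .
  qed
  \<comment> \<open>As the weight is independent of \<open>l\<close>, the sum over \<open>l\<close>
    collapses into the entries of \<open>y\<close>.\<close>
  also have "\<dots> = (\<Sum>i<d1. \<Sum>j<d2. y $ (i * d2 + j) * w (i * d2 + j))"
  proof -
    have "(\<Sum>l\<in>L. \<Sum>i<d1. \<Sum>j<d2. \<alpha> l i * \<beta> l j * ((\<omega> i j + \<omega>' i j) / 2))
        = (\<Sum>i<d1. \<Sum>j<d2. \<Sum>l\<in>L. \<alpha> l i * \<beta> l j * ((\<omega> i j + \<omega>' i j) / 2))"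
      by (subst sum.swap, rule sum.cong[OF refl], rule sum.swap)
    also have "\<dots> = (\<Sum>i<d1. \<Sum>j<d2. y $ (i * d2 + j) * w (i * d2 + j))"
      by (intro sum.cong refl) (simp only: y(2) w lessThan_iff sum_distrib_right)
    finally show ?thesis .
  qed
  also have "\<dots> = (\<Sum>p<dim_vec y. y $ p * w p)"
    using y(1) by (simp add: sum_pair_index sum.cartesian_product)
  also have "\<dots> \<le> (\<Sum>i<k. decreasing_rearrangement y $ i)"
  proof (rule weighted_sum_le_decreasing_rearrangement)
    fix p assume "p < dim_vec y"
    then have p: "p < d1 * d2" using y(1) by simp
    then have "d2 > 0" by (cases d2) auto
    then have ij: "p div d2 < d1" "p mod d2 < d2" using p by (auto simp: less_mult_imp_div_less)
    have "y $ p = (\<Sum>l\<in>L. \<alpha> l (p div d2) * \<beta> l (p mod d2))" using y(2)[OF ij] by simp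
    also have "\<dots> \<ge> 0"
      using A B ij by (intro sum_nonneg mult_nonneg_nonneg) (auto simp: bessel_decomposition_def)
    finally show "0 \<le> y $ p" .
    show "0 \<le> w p" using \<omega>(1) \<omega>'(1) ij by (simp add: w_def)
    show "w p \<le> 1" using \<omega>(2)[of "p div d2" "p mod d2"] \<omega>'(2)[of "p div d2" "p mod d2"] by (simp add: w_def)
  next
    have "(\<Sum>p<dim_vec y. w p) = (\<Sum>i<d1. \<Sum>j<d2. (\<omega> i j + \<omega>' i j) / 2)"
      using y(1) by (simp add: sum_pair_index w flip: sum.cartesian_product)
    also have "\<dots> = ((\<Sum>i<d1. \<Sum>j<d2. \<omega> i j) + (\<Sum>i<d1. \<Sum>j<d2. \<omega>' i j)) / 2"
      by (simp add: sum.distrib add_divide_distrib sum_divide_distrib)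
    also have "\<dots> \<le> real k" using \<omega>(3) \<omega>'(3) by simp
    finally show "(\<Sum>p<dim_vec y. w p) \<le> real k" .
  qed (use k y(1) in auto)
  finally show ?thesis .
qed

text \<open>Serves both claims: \<open>U\<close> and \<open>V\<close> will be the left and right
  singular vectors of the sum, or the same eigenbasis twice. As \<open>x\<close> is already
  decreasing, its \<open>k\<close> largest entries are the first \<open>k\<close> form
  values.\<close>

lemma tensor_sum_weakly_majorized:
  fixes A B :: "'l \<Rightarrow> complex mat" and x y :: "real vec"
  assumes L: "finite L"
    and A: "\<And>l. l \<in> L \<Longrightarrow> bessel_decomposition d1 (A l) (\<alpha> l) (a l) (a' l)"
    and B: "\<And>l. l \<in> L \<Longrightarrow> bessel_decomposition d2 (B l) (\<beta> l) (b l) (b' l)"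
    and X: "\<And>i i' j j'. i < d1 \<Longrightarrow> j < d2 \<Longrightarrow> i' < d1 \<Longrightarrow> j' < d2 \<Longrightarrow>
      X (i * d2 + j) (i' * d2 + j') = (\<Sum>l\<in>L. A l $$ (i, i') * B l $$ (j, j'))"
    and y: "y \<in> carrier_vec (d1 * d2)"
      "\<And>i j. i < d1 \<Longrightarrow> j < d2 \<Longrightarrow> y $ (i * d2 + j) = (\<Sum>l\<in>L. \<alpha> l i * \<beta> l j)"
    and x: "x \<in> carrier_vec (d1 * d2)" "\<And>i j. i \<le> j \<Longrightarrow> j < d1 * d2 \<Longrightarrow> x $ j \<le> x $ i"
      "\<And>p. p < d1 * d2 \<Longrightarrow> (\<Sum>s<d1 * d2. \<Sum>t<d1 * d2. cnj (U p s) * X s t * V p t) = of_real (x $ p)"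
    and U: "bessel {..<d1 * d2} {..<d1 * d2} U" and V: "bessel {..<d1 * d2} {..<d1 * d2} V"
  shows "weakly_majorized_by x y"
  unfolding weakly_majorized_by_def
proof (intro conjI ballI)
  show "dim_vec x = dim_vec y" using x(1) y(1) by simp
  fix k assume "k \<in> {1..dim_vec x}"
  then have k: "k \<le> d1 * d2" using x(1) by simp
  have "decreasing_rearrangement x = x"
    using x by (intro decreasing_rearrangement_id) auto
  then have "(\<Sum>i<k. decreasing_rearrangement x $ i)
      = Re (\<Sum>p<k. \<Sum>s<d1 * d2. \<Sum>t<d1 * d2. cnj (U p s) * X s t * V p t)"
    using x(3) k by simp
  also have "\<dots> \<le> (\<Sum>i<k. decreasing_rearrangement y $ i)"
    using bessel_subset[OF U, of "{..<k}"] bessel_subset[OF V, of "{..<k}"] k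
    by (intro tensor_sum_form_le[OF L A B X y]) auto
  finally show "(\<Sum>i<k. decreasing_rearrangement x $ i) \<le> (\<Sum>i<k. decreasing_rearrangement y $ i)" .
qed

section \<open>Entries of the sums, and the two majorizations\<close>

lemma index_finsum_tensor_mat:
  assumes "finite L" "\<And>l. l \<in> L \<Longrightarrow> A l \<in> carrier_mat d1 d1" "\<And>l. l \<in> L \<Longrightarrow> B l \<in> carrier_mat d2 d2"
    and "i < d1" "j < d2" "i' < d1" "j' < d2"
  shows "finsum_mat TYPE(complex) (d1 * d2) (d1 * d2) (\<lambda>l. tensor_mat (A l) (B l)) L
      $$ (i * d2 + j, i' * d2 + j') = (\<Sum>l\<in>L. A l $$ (i, i') * B l $$ (j, j'))"
proof -
  have "finsum_mat TYPE(complex) (d1 * d2) (d1 * d2) (\<lambda>l. tensor_mat (A l) (B l)) L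
      $$ (i * d2 + j, i' * d2 + j') = (\<Sum>l\<in>L. tensor_mat (A l) (B l) $$ (i * d2 + j, i' * d2 + j'))"
    using assms by (intro index_finsum_mat) (auto intro!: pair_index_less)
  also have "\<dots> = (\<Sum>l\<in>L. A l $$ (i, i') * B l $$ (j, j'))"
  proof (rule sum.cong[OF refl])
    fix l assume "l \<in> L"
    then show "tensor_mat (A l) (B l) $$ (i * d2 + j, i' * d2 + j') = A l $$ (i, i') * B l $$ (j, j')"
      using index_tensor_mat[of i "A l" j "B l" i' j'] assms(2)[of l] assms(3)[of l] assms(4-) by auto
  qed
  finally show ?thesis .
qed

lemma index_finsum_tensor_vec:
  fixes x y :: "'l \<Rightarrow> real vec"
  assumes "finite L" "\<And>l. l \<in> L \<Longrightarrow> x l \<in> carrier_vec d1" "\<And>l. l \<in> L \<Longrightarrow> y l \<in> carrier_vec d2"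
    and "i < d1" "j < d2"
  shows "finsum_vec TYPE(real) (d1 * d2) (\<lambda>l. tensor_vec (x l) (y l)) L $ (i * d2 + j)
    = (\<Sum>l\<in>L. x l $ i * y l $ j)"
proof -
  have "finsum_vec TYPE(real) (d1 * d2) (\<lambda>l. tensor_vec (x l) (y l)) L $ (i * d2 + j)
      = (\<Sum>l\<in>L. tensor_vec (x l) (y l) $ (i * d2 + j))"
    using assms by (intro index_finsum_vec) (auto intro!: pair_index_less)
  also have "\<dots> = (\<Sum>l\<in>L. x l $ i * y l $ j)"
  proof (rule sum.cong[OF refl])
    fix l assume "l \<in> L"
    then show "tensor_vec (x l) (y l) $ (i * d2 + j) = x l $ i * y l $ j"
      using index_tensor_vec[of i "x l" j "y l"] assms(2)[of l] assms(3)[of l] assms(4-) by auto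
  qed
  finally show ?thesis .
qed

theorem mainTheorem1:
  fixes m d1 d2 :: nat and A B :: "nat \<Rightarrow> complex mat"
  assumes "m > 0" "d1 > 0" "d2 > 0"
    and "\<And>l. l \<in> {1..m} \<Longrightarrow> A l \<in> carrier_mat d1 d1"
    and "\<And>l. l \<in> {1..m} \<Longrightarrow> B l \<in> carrier_mat d2 d2"
  shows "weakly_majorized_by
           (singular_value_vec
              (finsum_mat TYPE(complex) (d1 * d2) (d1 * d2) (\<lambda>l. tensor_mat (A l) (B l)) {1..m}))
           (finsum_vec TYPE(real) (d1 * d2)
              (\<lambda>l. tensor_vec (singular_value_vec (A l)) (singular_value_vec (B l))) {1..m})
       \<and> ((\<forall>l\<in>{1..m}. psd_mat (A l) \<and> psd_mat (B l)) \<longrightarrow>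
          majorized_by
            (eigenvalue_vec
               (finsum_mat TYPE(complex) (d1 * d2) (d1 * d2) (\<lambda>l. tensor_mat (A l) (B l)) {1..m}))
            (finsum_vec TYPE(real) (d1 * d2)
               (\<lambda>l. tensor_vec (eigenvalue_vec (A l)) (eigenvalue_vec (B l))) {1..m}))"
proof (intro conjI impI)
  let ?n = "d1 * d2" and ?L = "{1..m}"
  define X where "X = finsum_mat TYPE(complex) ?n ?n (\<lambda>l. tensor_mat (A l) (B l)) ?L"
  have X: "X \<in> carrier_mat ?n ?n"
    unfolding X_def using assms(4,5) by (intro finsum_mat_carrier) auto
  have Xi: "X $$ (i * d2 + j, i' * d2 + j') = (\<Sum>l\<in>?L. A l $$ (i, i') * B l $$ (j, j'))"
    if "i < d1" "j < d2" "i' < d1" "j' < d2" for i j i' j'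
    unfolding X_def using assms(4,5) that by (intro index_finsum_tensor_mat) auto
  show "weakly_majorized_by (singular_value_vec X)
      (finsum_vec TYPE(real) ?n (\<lambda>l. tensor_vec (singular_value_vec (A l)) (singular_value_vec (B l))) ?L)"
    (is "weakly_majorized_by _ ?y")
  proof -
    have "\<forall>l\<in>?L. \<exists>a a'. bessel_decomposition d1 (A l) (\<lambda>i. singular_value_vec (A l) $ i) a a'"
      using singular_value_decomposition[OF assms(4)] by metis
    then obtain a a' where A: "\<And>l. l \<in> ?L \<Longrightarrow>
        bessel_decomposition d1 (A l) (\<lambda>i. singular_value_vec (A l) $ i) (a l) (a' l)"
      by metis
    have "\<forall>l\<in>?L. \<exists>b b'. bessel_decomposition d2 (B l) (\<lambda>i. singular_value_vec (B l) $ i) b b'"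
      using singular_value_decomposition[OF assms(5)] by metis
    then obtain b b' where B: "\<And>l. l \<in> ?L \<Longrightarrow>
        bessel_decomposition d2 (B l) (\<lambda>i. singular_value_vec (B l) $ i) (b l) (b' l)"
      by metis
    obtain U V where UV: "bessel_decomposition ?n X (\<lambda>i. singular_value_vec X $ i) U V"
      "\<And>p. p < ?n \<Longrightarrow>
       (\<Sum>x<?n. \<Sum>y<?n. cnj (U p x) * X $$ (x, y) * V p y) = of_real (singular_value_vec X $ p)"
      by (rule singular_value_decomposition[OF X], rule that)
    show ?thesis
    proof (rule tensor_sum_weakly_majorized[where X = "\<lambda>s t. X $$ (s, t)", OF _ A B Xi])
      show "?y \<in> carrier_vec ?n" using assms(4,5) by (intro finsum_vec_closed) auto
      show "?y $ (i * d2 + j) = (\<Sum>l\<in>?L. singular_value_vec (A l) $ i * singular_value_vec (B l) $ j)"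
        if "i < d1" "j < d2" for i j
        using assms(4,5) that by (intro index_finsum_tensor_vec) auto
      show "bessel {..<?n} {..<?n} U" "bessel {..<?n} {..<?n} V"
        using UV(1) by (simp_all add: bessel_decomposition_def)
      show "singular_value_vec X $ j \<le> singular_value_vec X $ i" if "i \<le> j" "j < ?n" for i j
        using UV(1) that by (simp add: bessel_decomposition_def)
    qed (use UV(2) X in auto)
  qed
  assume psd: "\<forall>l\<in>?L. psd_mat (A l) \<and> psd_mat (B l)"
  show "majorized_by (eigenvalue_vec X)
      (finsum_vec TYPE(real) ?n (\<lambda>l. tensor_vec (eigenvalue_vec (A l)) (eigenvalue_vec (B l))) ?L)"
    (is "majorized_by _ ?y")
  proof -
    have hermA: "hermitian_mat (A l)" and hermB: "hermitian_mat (B l)" if "l \<in> ?L" for l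
      using psd that by (auto simp: psd_mat_def)
    have "\<forall>l\<in>?L. \<exists>a. bessel_decomposition d1 (A l) (\<lambda>i. eigenvalue_vec (A l) $ i) a a"
      using psd_bessel_decomposition[OF _ assms(4)] psd by metis
    then obtain a where A: "\<And>l. l \<in> ?L \<Longrightarrow>
        bessel_decomposition d1 (A l) (\<lambda>i. eigenvalue_vec (A l) $ i) (a l) (a l)"
      by metis
    have "\<forall>l\<in>?L. \<exists>b. bessel_decomposition d2 (B l) (\<lambda>i. eigenvalue_vec (B l) $ i) b b"
      using psd_bessel_decomposition[OF _ assms(5)] psd by metis
    then obtain b where B: "\<And>l. l \<in> ?L \<Longrightarrow>
        bessel_decomposition d2 (B l) (\<lambda>i. eigenvalue_vec (B l) $ i) (b l) (b l)"
      by metis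
    \<comment> \<open>Splitting \<open>p\<close> and \<open>q\<close> into pairs reduces the
      symmetry of \<open>X\<close> to that of the factors \<open>A l\<close> and
      \<open>B l\<close>.\<close>
    have "cnj (X $$ (p, q)) = X $$ (q, p)" if "p < ?n" "q < ?n" for p q
    proof -
      have d: "p div d2 < d1" "p mod d2 < d2" "q div d2 < d1" "q mod d2 < d2"
        using that assms(3) by (auto simp: less_mult_imp_div_less)
      show ?thesis
        using Xi[OF d] Xi[OF d(3,4,1,2)] d
        by (simp add: hermitian_index[OF hermA assms(4)] hermitian_index[OF hermB assms(5)])
    qed
    then have "mat_adjoint X = X"
      using X by (intro eq_matI) (auto simp: index_mat_adjoint)
    then have hermX: "hermitian_mat X" using X by (auto simp: hermitian_mat_def)
    obtain U where U: "orthonormal ?n ?n U"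
      "\<And>p. p < ?n \<Longrightarrow>
       (\<Sum>x<?n. \<Sum>y<?n. cnj (U p x) * X $$ (x, y) * U p y) = of_real (eigenvalue_vec X $ p)"
      by (rule hermitian_eigenvalue_attained[OF hermX X], rule that)
    have y: "?y \<in> carrier_vec ?n" using assms(4,5) by (intro finsum_vec_closed) auto
    have yi: "?y $ (i * d2 + j) = (\<Sum>l\<in>?L. eigenvalue_vec (A l) $ i * eigenvalue_vec (B l) $ j)"
      if "i < d1" "j < d2" for i j
      using assms(4,5) that by (intro index_finsum_tensor_vec) auto
    have x: "eigenvalue_vec X \<in> carrier_vec ?n" using X by auto
    have weak: "weakly_majorized_by (eigenvalue_vec X) ?y"
    proof (rule tensor_sum_weakly_majorized[where X = "\<lambda>s t. X $$ (s, t)", OF _ A B Xi y yi x])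
      show "eigenvalue_vec X $ j \<le> eigenvalue_vec X $ i" if "i \<le> j" "j < ?n" for i j
        using that x by (intro eigenvalue_vec_antimono) auto
    qed (use U orthonormal_bessel[OF U(1)] in auto)
    \<comment> \<open>Equality of the totals: the trace of \<open>X\<close> is the sum over
      \<open>l\<close> of the products of the traces of \<open>A l\<close> and \<open>B l\<close>,
      and each trace is the sum of the entries of an eigenvalue vector.\<close>
    have "complex_of_real (\<Sum>p<?n. eigenvalue_vec X $ p) = (\<Sum>p<?n. X $$ (p, p))"
      by (rule sum_eigenvalue_vec[OF hermX X])
    also have "\<dots> = (\<Sum>i<d1. \<Sum>j<d2. \<Sum>l\<in>?L. A l $$ (i, i) * B l $$ (j, j))"
      unfolding sum_pair_index by (simp add: Xi flip: sum.cartesian_product)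
    also have "\<dots> = (\<Sum>l\<in>?L. \<Sum>i<d1. \<Sum>j<d2. A l $$ (i, i) * B l $$ (j, j))"
      by (rule trans[OF sum.cong[OF refl sum.swap] sum.swap])
    also have "\<dots> = (\<Sum>l\<in>?L. of_real (\<Sum>i<d1. eigenvalue_vec (A l) $ i) * of_real (\<Sum>j<d2. eigenvalue_vec (B l) $ j))"
      by (simp only: sum_eigenvalue_vec[OF hermA assms(4)] sum_eigenvalue_vec[OF hermB assms(5)] sum_product cong: sum.cong)
    also have "\<dots> = of_real (\<Sum>l\<in>?L. \<Sum>i<d1. \<Sum>j<d2. eigenvalue_vec (A l) $ i * eigenvalue_vec (B l) $ j)"
      by (simp only: of_real_sum of_real_mult sum_product)
    also have "(\<Sum>l\<in>?L. \<Sum>i<d1. \<Sum>j<d2. eigenvalue_vec (A l) $ i * eigenvalue_vec (B l) $ j)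
        = (\<Sum>i<d1. \<Sum>j<d2. \<Sum>l\<in>?L. eigenvalue_vec (A l) $ i * eigenvalue_vec (B l) $ j)"
      by (subst sum.swap, rule sum.cong[OF refl], rule sum.swap)
    also have "\<dots> = (\<Sum>p<?n. ?y $ p)"
      unfolding sum_pair_index by (simp add: yi del: One_nat_def flip: sum.cartesian_product)
    finally have "(\<Sum>p<?n. eigenvalue_vec X $ p) = (\<Sum>p<?n. ?y $ p)"
      by (simp only: of_real_eq_iff)
    then show ?thesis
      using weak sum_decreasing_rearrangement[of "eigenvalue_vec X"] sum_decreasing_rearrangement[of ?y] x y
      by (simp add: majorized_by_def)
  qed
qed

end
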